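(* Let $0<q<1$, $v>-1$, and let $\omega:\mathbb R\to\mathbb R$ be an even function with $\omega(q^n)\neq 0$ for all $n\in\mathbb Z$. Let $\mu$ be the positive measure $d\mu(x)=\omega(x)^2|x|^{2v+1}d_qx$, where $d_qx=(1-q)\sum_{n\in\mathbb Z}q^n\delta_{q^n}$, and assume $\mu$ has finite moments of all orders. Let $(P_n)_{n\ge0}$ be the orthonormal polynomials of $\mu$. Then $(P_n)_{n\geq 0}$ is an orthonormal basis of $L^2(\mu)$ if and only if $\mu$ is determinate.
   Context: $\delta_a$ denotes the Dirac mass at $a$; the support of $\mu$ is the infinite set $\{q^n: n\in\mathbb Z\}$. The orthonormal polynomials $(P_n)$ of $\mu$ are the polynomials $P_n(x)=k_nx^n+\dots$ with $k_n>0$ and $\int P_nP_m\,d\mu=\delta_{nm}$. A positive measure $\mu$ on $\mathbb R$ with moments of all orders and infinite support is called determinate if it is the only positive measure on $\mathbb R$ with the same moments $s_n=\int x^n d\mu(x)$, $n\ge 0$; otherwise it is indeterminate. *)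

theory Defs
  imports "HOL-Analysis.Analysis" "HOL-Computational_Algebra.Polynomial"
begin

text \<open>The measure d mu(x) = omega(x)^2 |x|^(2v+1) d_q x, where
  d_q x = (1-q) sum_{n in Z} q^n delta_{q^n}.  It is the image of the measure
  on the integers giving mass (1-q) q^n omega(q^n)^2 |q^n|^(2v+1) to n under
  n |-> q^n, as a measure on the Borel sets of the real line.\<close>
definition q_measure :: "real \<Rightarrow> real \<Rightarrow> (real \<Rightarrow> real) \<Rightarrow> real measure" where
  "q_measure q v \<omega> =
     distr (density (count_space (UNIV :: int set))
              (\<lambda>n. ennreal ((1 - q) * q powi n * (\<omega> (q powi n))\<^sup>2 * \<bar>q powi n\<bar> powr (2 * v + 1))))
           borel (\<lambda>n. q powi n)"

definition has_all_moments :: "real measure \<Rightarrow> bool" where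
  "has_all_moments M \<longleftrightarrow> (\<forall>k::nat. integrable M (\<lambda>x. x ^ k))"

definition determinate :: "real measure \<Rightarrow> bool" where
  "determinate M \<longleftrightarrow>
     (\<forall>N. sets N = sets (borel :: real measure) \<and> has_all_moments N \<and>
          (\<forall>k::nat. (\<integral>x. x ^ k \<partial>N) = (\<integral>x. x ^ k \<partial>M)) \<longrightarrow> N = M)"

definition orthonormal_polys :: "real measure \<Rightarrow> (nat \<Rightarrow> real poly) \<Rightarrow> bool" where
  "orthonormal_polys M P \<longleftrightarrow>
     (\<forall>n. degree (P n) = n \<and> lead_coeff (P n) > 0) \<and>
     (\<forall>n m. integrable M (\<lambda>x. poly (P n) x * poly (P m) x) \<and>
            (\<integral>x. poly (P n) x * poly (P m) x \<partial>M) = (if n = m then 1 else 0))"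

definition L2 :: "real measure \<Rightarrow> (real \<Rightarrow> real) set" where
  "L2 M = {f. f \<in> borel_measurable M \<and> integrable M (\<lambda>x. (f x)\<^sup>2)}"

definition orthonormal_basis_L2 :: "real measure \<Rightarrow> (nat \<Rightarrow> real \<Rightarrow> real) \<Rightarrow> bool" where
  "orthonormal_basis_L2 M e \<longleftrightarrow>
     (\<forall>n. e n \<in> L2 M) \<and>
     (\<forall>n m. (\<integral>x. e n x * e m x \<partial>M) = (if n = m then 1 else 0)) \<and>
     (\<forall>f \<in> L2 M. \<forall>\<epsilon>>0. \<exists>N c. (\<integral>x. (f x - (\<Sum>k<N. c k * e k x))\<^sup>2 \<partial>M) < \<epsilon>)"

end

theory Submission
  imports Defs "HOL-Probability.Probability" "HOL-Complex_Analysis.Complex_Analysis"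
    "HOL-Real_Asymp.Real_Asymp" "HOL-Computational_Algebra.Fundamental_Theorem_Algebra"
begin

text \<open>Let \<open>\<mu>\<close> be the measure, which is purely atomic with atoms \<open>q\<^sup>n\<close> accumulating at 0.

  If the indicator of an atom \<open>x0\<close> is not an \<open>L\<^sup>2\<close>-limit of polynomials, then
  \<open>\<integral>p\<^sup>2 d\<mu> \<ge> \<rho> p(x0)\<^sup>2\<close> for some \<open>\<rho>\<close> exceeding the mass of \<open>x0\<close>, and Hamburger's construction (Gauss
  quadrature and Helly selection) produces a measure with the moments of \<open>\<mu>\<close> and larger mass at \<open>x0\<close>.
  Hence determinacy makes all these indicators approximable, which for an atomic measure is density.

  Conversely, if \<open>\<mu>\<close> is indeterminate, evaluation of polynomials at some nonreal point is bounded in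
  \<open>L\<^sup>2(\<mu>)\<close>. This spreads to a circle around 0 that avoids the support, and by the maximum principle
  to the disc inside. But if the polynomials are dense, the norm of the evaluation at \<open>q\<^sup>n\<close> is at least of
  the order of the inverse square root of the mass of \<open>q\<^sup>n\<close>, and these masses tend to 0.\<close>

subsection \<open>Gauss quadrature for functionals positive on squares\<close>

text \<open>Only an excess at \<open>x0\<close> can contradict determinacy: weak limits may lose
  mass at a point of nearby measures only to its neighbourhood, while a lower bound for the mass at
  \<open>x0\<close> survives, as tent functions around \<open>x0\<close> show. This is why the
  functional subtracts a \<open>\<rho>\<close> above the true mass. In the converse, the competing
  measure is arbitrary and need not be atomic. No general inversion formula is required, because
  equal total mass and equal point masses on the support of \<open>\<mu>\<close> already force
  equality. A bound at a nonreal point cannot be moved to the atoms directly: the transfer divides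
  by x - z, and the atoms even accumulate at 0. The gap between q and 1 in the support leaves room
  for a circle at positive distance from it. The radius cannot be prescribed, because the transfer
  also divides by a holomorphic function with possible zeros there. The final contradiction is
  quantitative: a polynomial close to the indicator of an atom of mass a has value near 1 at the
  atom and squared norm of order a, while the atoms inside the circle share one evaluation constant
  and their masses have a finite sum.\<close>

locale positive_poly_functional =
  fixes L :: "real poly \<Rightarrow> real"
  assumes add: "L (p + r) = L p + L r"
    and smult: "L (smult c p) = c * L p"
    and square_pos: "p \<noteq> 0 \<Longrightarrow> L (p * p) > 0"
begin

lemma zero [simp]: "L 0 = 0"
  using smult[of 0 0] by simp

lemma diff: "L (p - r) = L p - L r"
  using add[of p "smult (-1) r"] smult[of "-1" r] by simp

lemma sum: "L (\<Sum>i\<in>I. f i) = (\<Sum>i\<in>I. L (f i))"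
  by (induction I rule: infinite_finite_induct) (auto simp: add)

lemma square_nonneg: "L (p * p) \<ge> 0"
  using square_pos[of p] by (cases "p = 0") auto

definition orthogonal_poly :: "real poly \<Rightarrow> bool" where
  "orthogonal_poly Q \<longleftrightarrow> lead_coeff Q = 1 \<and> (\<forall>r. degree r < degree Q \<longrightarrow> L (Q * r) = 0)"

end

text \<open>Subtracting the multiple of \<open>Q n\<close> that cancels the coefficient at n lowers
  the degree bound. The alternative \<open>p = 0\<close> is what the induction reaches at n = 0,
  since the zero polynomial has degree 0.\<close>

lemma poly_in_span_graded:
  fixes Q :: "nat \<Rightarrow> 'a::field poly"
  assumes "\<And>k. k < n \<Longrightarrow> degree (Q k) = k" "\<And>k. k < n \<Longrightarrow> Q k \<noteq> 0"
    and "p = 0 \<or> degree p < n"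
  shows "\<exists>c. p = (\<Sum>k<n. smult (c k) (Q k))"
  using assms
proof (induction n arbitrary: p)
  case 0
  then show ?case by simp
next
  case (Suc n)
  define a where "a = coeff p n / lead_coeff (Q n)"
  have dQ: "degree (Q n) = n" "Q n \<noteq> 0" using Suc.prems by auto
  have le: "degree (p - smult a (Q n)) \<le> n"
    using Suc.prems(3) dQ by (intro degree_diff_le) (auto simp: less_Suc_eq_le)
  have "coeff (p - smult a (Q n)) n = 0"
    using dQ unfolding a_def by (metis coeff_diff coeff_smult diff_self leading_coeff_0_iff nonzero_eq_divide_eq)
  then have "p - smult a (Q n) = 0 \<or> degree (p - smult a (Q n)) < n"
    using le by (metis eq_zero_or_degree_less)
  then obtain c where c: "p - smult a (Q n) = (\<Sum>k<n. smult (c k) (Q k))"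
    using Suc.IH[of "p - smult a (Q n)"] Suc.prems(1,2) by auto
  show ?case
    using c by (intro exI[of _ "c(n := a)"]) (simp add: algebra_simps)
qed

context positive_poly_functional
begin

text \<open>Gram-Schmidt: \<open>R\<close> is the projection of the n-th monomial onto the earlier
  orthogonal polynomials. The denominators \<open>L (Q k * Q k)\<close> are nonzero by strict
  positivity on squares.\<close>

lemma orthogonal_poly_exists: "\<exists>Q. degree Q = n \<and> orthogonal_poly Q"
proof (induction n rule: less_induct)
  case (less n)
  then obtain Q where Q: "\<And>k. k < n \<Longrightarrow> degree (Q k) = k" "\<And>k. k < n \<Longrightarrow> orthogonal_poly (Q k)"
    by metis
  have nz: "Q k \<noteq> 0" if "k < n" for k
    using Q(2)[OF that] by (auto simp: orthogonal_poly_def)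
  define R where "R = (\<Sum>k<n. smult (L (monom 1 n * Q k) / L (Q k * Q k)) (Q k))"
  have orth: "L (Q k * Q l) = 0" if "k < n" "l < n" "k \<noteq> l" for k l
  proof (cases "k < l")
    case True
    then show ?thesis using Q that unfolding orthogonal_poly_def by (metis mult.commute)
  next
    case False
    then show ?thesis using Q that unfolding orthogonal_poly_def by (metis linorder_neqE_nat)
  qed
  have RQ: "L ((monom 1 n - R) * Q l) = 0" if "l < n" for l
  proof -
    have "L (R * Q l) = (\<Sum>k<n. (L (monom 1 n * Q k) / L (Q k * Q k)) * L (Q k * Q l))"
      by (simp add: R_def sum_distrib_right sum smult)
    also have "\<dots> = (\<Sum>k<n. if k = l then L (monom 1 n * Q k) else 0)"
      using that orth square_pos[OF nz] by (intro sum.cong) (auto simp: less_imp_neq[symmetric])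
    finally show ?thesis using that by (simp add: algebra_simps diff)
  qed
  have dR: "degree R \<le> n - 1"
    unfolding R_def using Q(1) by (intro degree_sum_le) (auto intro: order.trans[OF degree_smult_le])
  \<comment> \<open>Truncated subtraction makes the preceding degree bound say nothing about this
    coefficient when n = 0.\<close>
  have Rn: "coeff R n = 0"
    unfolding R_def coeff_sum using Q(1) by (intro sum.neutral) (auto simp: coeff_eq_0)
  have c1: "coeff (monom 1 n - R) n = 1" using Rn by simp
  have "degree (monom 1 n - R) \<le> n"
    using dR by (intro degree_diff_le) (auto simp: degree_monom_le)
  with c1 have dn: "degree (monom 1 n - R) = n"
    by (metis le_degree le_antisym zero_neq_one)
  have "L ((monom 1 n - R) * r) = 0" if r: "degree r < n" for r
  proof -
    obtain c where "r = (\<Sum>k<n. smult (c k) (Q k))"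
      using poly_in_span_graded[of n Q r] Q(1) nz r by auto
    then show ?thesis
      by (simp add: sum_distrib_left sum smult RQ)
  qed
  then show ?case
    using dn c1 by (intro exI[of _ "monom 1 n - R"]) (auto simp: orthogonal_poly_def)
qed

end

lemma prod_linear_dvd:
  fixes Q :: "'a::field poly"
  assumes "finite Z" "\<And>z. z \<in> Z \<Longrightarrow> poly Q z = 0"
  shows "(\<Prod>z\<in>Z. [:-z, 1:]) dvd Q"
  using assms
proof (induction Z rule: finite_induct)
  case (insert z Z)
  then obtain s where s: "Q = (\<Prod>z\<in>Z. [:-z, 1:]) * s" by (auto simp: dvd_def)
  have "poly (\<Prod>z\<in>Z. [:-z, 1:]) z \<noteq> 0"
    using insert.hyps by (auto simp: poly_prod)
  then have "poly s z = 0" using insert.prems[of z] s by auto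
  then have "[:-z,1:] dvd s" by (simp add: poly_eq_0_iff_dvd)
  then have "[:-z,1:] * (\<Prod>z\<in>Z. [:-z, 1:]) dvd s * (\<Prod>z\<in>Z. [:-z, 1:])"
    by (rule mult_dvd_mono) simp
  then show ?case using insert.hyps s by (metis mult.commute prod.insert)
qed simp

abbreviation cpoly :: "real poly \<Rightarrow> complex \<Rightarrow> complex" where
  "cpoly p \<equiv> poly (map_poly complex_of_real p)"

lemma map_poly_of_real_add: "map_poly complex_of_real (p + r) = map_poly of_real p + map_poly of_real r"
  by (intro poly_eqI) (simp add: coeff_map_poly)

lemma map_poly_of_real_mult: "map_poly complex_of_real (p * r) = map_poly of_real p * map_poly of_real r"
  by (intro poly_eqI) (simp add: coeff_map_poly coeff_mult)

lemma cpoly_smult: "cpoly (smult c p) z = of_real c * cpoly p z"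
  by (simp add: map_poly_smult)

lemma cpoly_sum: "cpoly (\<Sum>i\<in>I. f i) z = (\<Sum>i\<in>I. cpoly (f i) z)"
  by (induction I rule: infinite_finite_induct) (auto simp: map_poly_of_real_add)

lemma cpoly_of_real: "cpoly p (of_real x) = of_real (poly p x)"
  by (induction p) (auto simp: map_poly_pCons)

text \<open>The remainder modulo the real quadratic with roots w and its conjugate is a + b x with
  real a and b. It vanishes at the nonreal w, so b = 0 and then a = 0.\<close>

lemma real_quadratic_dvd:
  assumes root: "cpoly p w = 0" and im: "Im w \<noteq> 0"
  shows "[:(Re w)\<^sup>2 + (Im w)\<^sup>2, - 2 * Re w, 1:] dvd p"
proof -
  let ?d = "[:(Re w)\<^sup>2 + (Im w)\<^sup>2, - 2 * Re w, 1:]"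
  have dw: "cpoly ?d w = 0"
    by (simp add: map_poly_pCons complex_eq_iff power2_eq_square algebra_simps)
  have deg: "degree (p mod ?d) \<le> 1"
    using degree_mod_less[of ?d p] by auto
  obtain a b where ab: "p mod ?d = [:a, b:]"
  proof
    show "p mod ?d = [:coeff (p mod ?d) 0, coeff (p mod ?d) 1:]"
      using deg by (intro poly_eqI) (auto simp: coeff_pCons coeff_eq_0 split: nat.split)
  qed
  have "p = ?d * (p div ?d) + [:a, b:]" using ab by (metis mult_div_mod_eq)
  then have "cpoly p w = cpoly ?d w * cpoly (p div ?d) w + cpoly [:a, b:] w"
    by (metis map_poly_of_real_add map_poly_of_real_mult poly_add poly_mult)
  then have "of_real a + w * of_real b = 0"
    using root dw by (simp add: map_poly_pCons)
  then have "b = 0" "a = 0" using im by (auto simp: complex_eq_iff)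
  then show ?thesis using ab by (simp add: mod_eq_0_iff_dvd)
qed

context positive_poly_functional
begin

text \<open>Writing \<open>Q = d r\<close> with \<open>d = (x - a)\<^sup>2 + b\<^sup>2\<close>, orthogonality to \<open>r\<close> would
  make the functional vanish on the sum of squares \<open>d r\<^sup>2\<close>.\<close>
lemma orthogonal_poly_not_dvd:
  assumes Q: "orthogonal_poly Q"
  shows "\<not> [:a\<^sup>2 + b\<^sup>2, - 2 * a, 1:] dvd Q"
proof
  let ?d = "[:a\<^sup>2 + b\<^sup>2, - 2 * a, 1:]"
  assume "?d dvd Q"
  then obtain r where r: "Q = ?d * r" by (auto simp: dvd_def)
  have "Q \<noteq> 0" using Q by (auto simp: orthogonal_poly_def)
  then have "r \<noteq> 0" using r by auto
  have "degree Q = 2 + degree r" using \<open>r \<noteq> 0\<close> r by (subst r, subst degree_mult_eq) auto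
  then have "L (Q * r) = 0" using Q by (auto simp: orthogonal_poly_def)
  moreover have "Q * r = ([:-a,1:] * r) * ([:-a,1:] * r) + smult (b\<^sup>2) (r * r)"
    unfolding r by (subst poly_eq_poly_eq_iff[symmetric]) (auto simp: fun_eq_iff algebra_simps power2_eq_square)
  moreover have "L (([:-a,1:] * r) * ([:-a,1:] * r)) > 0"
    using \<open>r \<noteq> 0\<close> by (intro square_pos) (simp only: mult_eq_0_iff pCons_eq_0_iff, simp)
  ultimately show False
    using square_nonneg[of r] mult_nonneg_nonneg[of "b\<^sup>2" "L (r * r)"]
    by (metis add smult add_pos_nonneg less_irrefl zero_le_power2)
qed

text \<open>A nonconstant cofactor of the linear factors would have a complex root. If nonreal, it
  yields a real quadratic factor of \<open>Q\<close>; if real, it is a double root, which is the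
  case b = 0 of the same excluded factor. Hence all roots are real and simple.\<close>

lemma orthogonal_poly_splits:
  assumes Q: "orthogonal_poly Q"
  shows "Q = (\<Prod>z | poly Q z = 0. [:-z, 1:])"
proof -
  define Z where "Z = {z. poly Q z = 0}"
  have Q0: "Q \<noteq> 0" using Q by (auto simp: orthogonal_poly_def)
  then have fin: "finite Z" unfolding Z_def by (rule poly_roots_finite)
  define W where "W = (\<Prod>z\<in>Z. [:-z, 1:])"
  have "W dvd Q" unfolding W_def using fin by (intro prod_linear_dvd) (auto simp: Z_def)
  then obtain r where r: "Q = W * r" by (auto simp: dvd_def)
  have lW: "lead_coeff W = 1" by (simp add: W_def lead_coeff_prod)
  have "degree r = 0"
  proof (rule ccontr)
    assume "degree r \<noteq> 0"
    then have "\<not> constant (cpoly r)"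
      by (simp add: constant_degree degree_map_poly)
    then obtain w where w: "cpoly r w = 0" using fundamental_theorem_of_algebra by blast
    show False
    proof (cases "Im w = 0")
      case False
      then have "[:(Re w)\<^sup>2 + (Im w)\<^sup>2, - 2 * Re w, 1:] dvd Q"
        using real_quadratic_dvd[OF w] r by simp
      then show False using orthogonal_poly_not_dvd[OF Q] by blast
    next
      case True
      then have "w = of_real (Re w)" by (simp add: complex_eq_iff)
      then have wr: "poly r (Re w) = 0" using w cpoly_of_real[of r "Re w"] by simp
      then have "Re w \<in> Z" by (simp add: Z_def r)
      then have "[:-Re w, 1:] dvd W" unfolding W_def using fin by (rule dvd_prodI[rotated])
      moreover have "[:-Re w, 1:] dvd r" using wr by (simp add: poly_eq_0_iff_dvd)
      ultimately have "[:-Re w, 1:] * [:-Re w, 1:] dvd Q" unfolding r by (rule mult_dvd_mono)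
      moreover have "[:-Re w, 1:] * [:-Re w, 1:] = [:(Re w)\<^sup>2 + 0\<^sup>2, - 2 * Re w, 1:]"
        by (simp add: power2_eq_square)
      ultimately show False using orthogonal_poly_not_dvd[OF Q, of "Re w" 0] by metis
    qed
  qed
  then obtain c where c: "r = [:c:]" by (rule degree_eq_zeroE)
  moreover have "lead_coeff Q = 1" using Q by (simp add: orthogonal_poly_def)
  ultimately have "c = 1" using lW by (simp only: r lead_coeff_mult) simp
  then show ?thesis using r c by (simp add: W_def Z_def)
qed

text \<open>The nodes are the zeros of the orthogonal polynomial \<open>Q\<close> of degree n. Below
  degree 2n, division by \<open>Q\<close> leaves a quotient of degree below n, whose product with
  \<open>Q\<close> is killed by \<open>L\<close>, and a remainder that Lagrange interpolation at the
  n nodes reproduces.\<close>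

lemma gauss_quadrature:
  "\<exists>Z w. finite Z \<and> (\<forall>z\<in>Z. w z \<ge> 0) \<and>
     (\<forall>p. degree p < 2 * n \<longrightarrow> L p = (\<Sum>z\<in>Z. w z * poly p z))"
proof (cases "n = 0")
  case False
  obtain Q where Qn: "degree Q = n" and Q: "orthogonal_poly Q"
    using orthogonal_poly_exists by blast
  define Z where "Z = {z. poly Q z = 0}"
  have Q0: "Q \<noteq> 0" using Q by (auto simp: orthogonal_poly_def)
  then have fin: "finite Z" unfolding Z_def by (rule poly_roots_finite)
  have QZ: "Q = (\<Prod>z\<in>Z. [:-z, 1:])" unfolding Z_def by (rule orthogonal_poly_splits[OF Q])
  have "degree Q = card Z" by (subst QZ, subst degree_prod_sum_eq) auto
  then have card: "card Z = n" using Qn by simp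
  define l where "l z = smult (1 / (\<Prod>y\<in>Z - {z}. z - y)) (\<Prod>y\<in>Z - {z}. [:-y, 1:])" for z
  have l_eval: "poly (l z) y = (if y = z then 1 else 0)" if "z \<in> Z" "y \<in> Z" for z y
  proof (cases "y = z")
    case True
    have "(\<Prod>y\<in>Z - {z}. z - y) \<noteq> 0" using fin by auto
    then show ?thesis using True by (simp add: l_def poly_prod)
  next
    case False
    then have "(\<Prod>x\<in>Z - {z}. y - x) = 0" using fin that by (auto simp: prod_zero_iff)
    then show ?thesis using False by (simp add: l_def poly_prod)
  qed
  have l_deg: "degree (l z) < n" if "z \<in> Z" for z
  proof -
    have "degree (\<Prod>y\<in>Z - {z}. [:-y, 1:]) = card (Z - {z})"
      by (subst degree_prod_sum_eq) auto
    then have "degree (l z) \<le> n - 1"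
      using that fin card by (auto simp: l_def intro: order.trans[OF degree_smult_le])
    then show ?thesis using False by linarith
  qed
  have quad: "L p = (\<Sum>z\<in>Z. L (l z) * poly p z)" if p: "degree p < 2 * n" for p
  proof -
    define s where "s = p div Q"
    define r where "r = p mod Q"
    have psr: "p = Q * s + r" by (simp add: s_def r_def)
    have rd: "degree r < n"
      using degree_mod_less[OF Q0, of p] Qn False by (auto simp: r_def)
    have "L (Q * s) = 0"
    proof (cases "s = 0")
      case False
      have "degree (Q * s) = n + degree s" using False Q0 Qn by (simp add: degree_mult_eq)
      moreover have "degree (Q * s) < 2 * n"
        using degree_diff_less[of p "2*n" r] p rd by (simp add: psr)
      ultimately have "degree s < degree Q" using Qn by simp
      then show ?thesis using Q by (auto simp: orthogonal_poly_def)
    qed simp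
    moreover have "r = (\<Sum>z\<in>Z. smult (poly p z) (l z))"
    proof (rule poly_eqI_degree[of Z])
      show "poly r x = poly (\<Sum>z\<in>Z. smult (poly p z) (l z)) x" if "x \<in> Z" for x
      proof -
        have "poly r x = poly p x" using that psr by (simp add: Z_def)
        moreover have "poly (\<Sum>z\<in>Z. smult (poly p z) (l z)) x = (\<Sum>z\<in>Z. if z = x then poly p z else 0)"
          unfolding poly_sum using that by (intro sum.cong) (auto simp: l_eval)
        ultimately show ?thesis using that fin by simp
      qed
      show "degree r < card Z" using rd card by simp
      have "degree (\<Sum>z\<in>Z. smult (poly p z) (l z)) \<le> n - 1"
        using l_deg fin False by (intro degree_sum_le) (auto intro!: order.trans[OF degree_smult_le] simp: less_Suc_eq_le[symmetric])
      then show "degree (\<Sum>z\<in>Z. smult (poly p z) (l z)) < card Z" using False card by simp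
    qed
    ultimately show ?thesis
      by (subst psr) (simp add: add sum smult mult.commute)
  qed
  \<comment> \<open>The square of a Lagrange polynomial still has degree below 2n and the same
    values 0 and 1 at the nodes, so the rule identifies the weight with \<open>L\<close> of a
    square.\<close>
  have "L (l z) \<ge> 0" if "z \<in> Z" for z
  proof -
    have "degree (l z * l z) < 2 * n"
      using degree_mult_le[of "l z" "l z"] l_deg[OF that] by linarith
    then have "L (l z * l z) = (\<Sum>y\<in>Z. L (l y) * poly (l z * l z) y)" by (rule quad)
    also have "\<dots> = (\<Sum>y\<in>Z. if y = z then L (l y) else 0)"
      using that by (intro sum.cong) (auto simp: l_eval)
    also have "\<dots> = L (l z)" using that fin by simp
    finally show ?thesis using square_nonneg[of "l z"] by simp
  qed
  then show ?thesis
    using fin quad by (intro exI[of _ Z] exI[of _ "\<lambda>z. L (l z)"] conjI) simp_all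
next
  case True
  then show ?thesis by (intro exI[of _ "{}"]) simp
qed

end

subsection \<open>Limits of measures with stabilising moments\<close>

text \<open>Where the clamp acts, |x| is at least T and at least 1, so a factor T is absorbed by
  extra powers of |x|. The even exponent turns the bound into an ordinary moment without absolute
  values.\<close>

lemma power_clamp_diff_le:
  fixes x T :: real
  assumes "T \<ge> 1"
  shows "\<bar>x ^ k - (max (- T) (min T x)) ^ k\<bar> \<le> 2 * x ^ (2 * k + 2) / T"
proof (cases "\<bar>x\<bar> \<le> T")
  case True
  then have "max (- T) (min T x) = x" by auto
  moreover have "0 \<le> x ^ (2 * k + 2)" by (intro zero_le_even_power) simp
  ultimately show ?thesis using assms by simp
next
  case False
  then have x: "\<bar>x\<bar> \<ge> T" "\<bar>x\<bar> \<ge> 1" using assms by auto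
  have "\<bar>max (- T) (min T x)\<bar> \<le> \<bar>x\<bar>" using assms by auto
  then have "\<bar>max (- T) (min T x) ^ k\<bar> \<le> \<bar>x\<bar> ^ k"
    unfolding power_abs by (intro power_mono) auto
  then have "\<bar>x ^ k - (max (- T) (min T x)) ^ k\<bar> \<le> 2 * \<bar>x\<bar> ^ k"
    using abs_triangle_ineq4[of "x ^ k" "(max (- T) (min T x)) ^ k"] by (simp add: power_abs)
  also have "\<dots> \<le> 2 * x ^ (2 * k + 2) / T"
  proof -
    have "\<bar>x\<bar> ^ k * T \<le> \<bar>x\<bar> ^ k * \<bar>x\<bar> ^ (k + 2)"
      using x order.trans[OF x(1), of "\<bar>x\<bar> ^ (k + 2)"] self_le_power[of "\<bar>x\<bar>" "k + 2"]
      by (intro mult_left_mono) auto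
    also have "\<dots> = \<bar>x\<bar> ^ (2 * k + 2)" by (simp add: power_add[symmetric] mult_2)
    also have "\<dots> = x ^ (2 * k + 2)" by (simp add: power_even_abs)
    finally show ?thesis using assms by (simp add: field_simps)
  qed
  finally show ?thesis .
qed

text \<open>Chebyshev's inequality, with the half-open interval that \<open>tight\<close>
  uses.\<close>

lemma (in real_distribution) tail_bound:
  assumes "integrable M (\<lambda>x. x\<^sup>2)" "T > 0"
  shows "measure M {-T<..T} \<ge> 1 - (\<integral>x. x\<^sup>2 \<partial>M) / T\<^sup>2"
proof -
  have "measure M {-T<..T} = (\<integral>x. indicator {-T<..T} x \<partial>M)" by simp
  also have "\<dots> \<ge> (\<integral>x. 1 - x\<^sup>2 / T\<^sup>2 \<partial>M)"
  proof (rule integral_mono)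
    show "integrable M (\<lambda>x. 1 - x\<^sup>2 / T\<^sup>2)" using assms by auto
    show "integrable M (indicator {-T<..T} :: real \<Rightarrow> real)" by (simp add: integrable_indicator_iff emeasure_eq_measure)
    fix x
    show "1 - x\<^sup>2 / T\<^sup>2 \<le> indicator {-T<..T} x"
    proof (cases "x \<in> {-T<..T}")
      case False
      then have "\<bar>x\<bar> \<ge> T" by auto
      then have "x\<^sup>2 \<ge> T\<^sup>2" using assms by (metis abs_le_square_iff abs_of_pos)
      then show ?thesis using False assms by (simp add: field_simps)
    qed simp
  qed
  also have "(\<integral>x. 1 - x\<^sup>2 / T\<^sup>2 \<partial>M) = 1 - (\<integral>x. x\<^sup>2 \<partial>M) / T\<^sup>2"
    using assms prob_space by simp
  finally show ?thesis by simp
qed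

text \<open>Each moment stabilises along the sequence, so the higher moments bound the tails uniformly.\<close>
lemma moment_convergent_subsequence:
  fixes \<nu> :: "nat \<Rightarrow> real measure" and s :: "nat \<Rightarrow> real"
  assumes rd: "\<And>n. real_distribution (\<nu> n)"
    and int: "\<And>n k. integrable (\<nu> n) (\<lambda>x. x ^ k)"
    and mom: "\<And>n k. k \<le> n + 2 \<Longrightarrow> (\<integral>x. x ^ k \<partial>\<nu> n) = s k"
  obtains r N where "strict_mono (r :: nat \<Rightarrow> nat)" "real_distribution N"
    "\<forall>(f :: real \<Rightarrow> real) B. (\<forall>x. isCont f x) \<longrightarrow> (\<forall>x. norm (f x) \<le> B) \<longrightarrow>
       (\<lambda>n. \<integral>x. f x \<partial>\<nu> (r n)) \<longlonglongrightarrow> (\<integral>x. f x \<partial>N)"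
    "\<And>k. integrable N (\<lambda>x. x ^ k)" "\<And>k. (\<integral>x. x ^ k \<partial>N) = s k"
proof -
  \<comment> \<open>Tightness concerns every index, so the second moment has to be correct already
    at n = 0; hence the range \<open>k \<le> n + 2\<close> in the assumption.\<close>
  have "tight \<nu>"
    unfolding tight_def
  proof (intro conjI allI impI rd)
    fix \<epsilon> :: real assume "\<epsilon> > 0"
    \<comment> \<open>The maximum with 1 gives \<open>T \<le> T\<^sup>2\<close>, and the added 1
      makes the resulting tail estimate strict.\<close>
    define T where "T = max 1 ((\<bar>s 2\<bar> + 1) / \<epsilon>)"
    have T: "T \<ge> 1" "T > 0" by (auto simp: T_def)
    have "s 2 / T\<^sup>2 < \<epsilon>"
    proof -
      have "(\<bar>s 2\<bar> + 1) \<le> \<epsilon> * T" using \<open>\<epsilon> > 0\<close> by (auto simp: T_def field_simps max_def)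
      also have "\<dots> \<le> \<epsilon> * T\<^sup>2" using T \<open>\<epsilon> > 0\<close> by (simp add: power2_eq_square)
      finally show ?thesis using T by (simp add: field_simps)
    qed
    moreover have "measure (\<nu> n) {-T<..T} \<ge> 1 - s 2 / T\<^sup>2" for n
      using real_distribution.tail_bound[OF rd int T(2), of n] mom[of 2 n] by simp
    ultimately have "measure (\<nu> n) {-T<..T} > 1 - \<epsilon>" for n
      by (smt (verit))
    then show "\<exists>a b. a < b \<and> (\<forall>n. measure (\<nu> n) {a<..b} > 1 - \<epsilon>)"
      using T by (intro exI[of _ "-T"] exI[of _ T]) auto
  qed
  then obtain r N where r: "strict_mono r" and N: "real_distribution N" and wc: "weak_conv_m (\<nu> \<circ> r) N"
    using tight_imp_convergent_subsubsequence[of \<nu> id] by (auto simp: strict_mono_id comp_def)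
  interpret N: real_distribution N by fact
  interpret \<nu>: real_distribution "\<nu> n" for n by fact
  have conv: "(\<lambda>n. \<integral>x. f x \<partial>\<nu> (r n)) \<longlonglongrightarrow> (\<integral>x. f x \<partial>N)"
    if "\<And>x. isCont f x" "\<And>x. norm (f x) \<le> B" for f :: "real \<Rightarrow> real" and B
    using weak_conv_imp_integral_bdd_continuous_conv[OF _ N wc that] rd by (simp add: comp_def)
  have ev: "\<forall>\<^sub>F n in sequentially. (\<integral>x. x ^ k \<partial>\<nu> (r n)) = s k" for k
    using eventually_ge_at_top[of k]
  proof eventually_elim
    case (elim n)
    then show ?case using seq_suble[OF r, of n] by (intro mom) simp
  qed
  \<comment> \<open>Weak convergence sees only bounded continuous functions. Truncating the even
    power at height i and letting i grow gives a Fatou-type inequality, which suffices for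
    integrability and for the error terms below.\<close>
  have even_int: "integrable N (\<lambda>x. x ^ (2 * k)) \<and> (\<integral>x. x ^ (2 * k) \<partial>N) \<le> s (2 * k)" for k
  proof -
    define f where "f i x = min (real i) (x ^ (2 * k))" for i :: nat and x :: real
    have f_nonneg: "f i x \<ge> 0" for i x by (simp add: f_def)
    have f_int: "integrable N (f i)" for i
    proof (rule N.integrable_const_bound[of _ "real i"])
      show "f i \<in> borel_measurable N" unfolding f_def by measurable
    qed (auto simp: f_def)
    have "(\<integral>x. f i x \<partial>N) \<le> s (2 * k)" for i
    proof (rule tendsto_upperbound[OF conv])
      show "isCont (f i) x" for x unfolding f_def by (intro continuous_intros)
      show "norm (f i x) \<le> real i" for x using f_nonneg[of i x] by (simp add: f_def)
      show "\<forall>\<^sub>F n in sequentially. (\<integral>x. f i x \<partial>\<nu> (r n)) \<le> s (2 * k)"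
        using ev[of "2 * k"]
      proof eventually_elim
        case (elim n)
        have "(\<integral>x. f i x \<partial>\<nu> (r n)) \<le> (\<integral>x. x ^ (2 * k) \<partial>\<nu> (r n))"
          by (intro integral_mono int \<nu>.integrable_const_bound[of _ "real i"]) (auto simp: f_def)
        then show ?case using elim by simp
      qed
    qed simp
    then have bound: "(\<integral>x. f i x \<partial>N) \<le> s (2 * k)" for i .
    have conv_inc: "\<exists>L. (\<lambda>i. \<integral>x. f i x \<partial>N) \<longlonglongrightarrow> L \<and> L \<le> s (2*k)"
    proof -
      have "incseq (\<lambda>i. \<integral>x. f i x \<partial>N)"
        by (intro incseq_SucI integral_mono f_int) (auto simp: f_def)
      then obtain L where "(\<lambda>i. \<integral>x. f i x \<partial>N) \<longlonglongrightarrow> L"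
        using incseq_convergent[of _ "s (2*k)"] bound by blast
      moreover then have "L \<le> s (2*k)" by (rule LIMSEQ_le_const2) (use bound in auto)
      ultimately show ?thesis by blast
    qed
    then obtain L where L: "(\<lambda>i. \<integral>x. f i x \<partial>N) \<longlonglongrightarrow> L" "L \<le> s (2*k)" by blast
    have lim: "(\<lambda>i. f i x) \<longlonglongrightarrow> x ^ (2 * k)" for x
    proof (rule tendsto_eventually)
      show "\<forall>\<^sub>F i in sequentially. f i x = x ^ (2 * k)"
        using eventually_ge_at_top[of "nat \<lceil>x ^ (2 * k)\<rceil>"]
        by eventually_elim (auto simp: f_def min_def)
    qed
    have mono_f: "mono (\<lambda>i. f i x)" for x by (auto simp: f_def mono_def min_def)
    have "integrable N (\<lambda>x. x ^ (2 * k))"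
      by (rule integrable_monotone_convergence[where f=f and x=L]) (use f_int mono_f lim L in auto)
    moreover have "(\<integral>x. x ^ (2 * k) \<partial>N) = L"
      by (rule integral_monotone_convergence[where f=f]) (use f_int mono_f lim L in auto)
    ultimately show ?thesis using L by simp
  qed
  have N_int: "integrable N (\<lambda>x. x ^ k)" for k
  proof (rule Bochner_Integration.integrable_bound[of _ "\<lambda>x. 1 + x ^ (2 * k)"])
    show "integrable N (\<lambda>x. 1 + x ^ (2 * k))" using even_int[of k] by auto
    show "AE x in N. norm (x ^ k) \<le> norm (1 + x ^ (2 * k))"
    proof (rule AE_I2)
      fix x :: real
      have "2 * \<bar>x ^ k\<bar> \<le> 1 + (x ^ k)\<^sup>2"
        using zero_le_power2[of "\<bar>x ^ k\<bar> - 1"] by (simp add: power2_eq_square algebra_simps)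
      then show "norm (x ^ k) \<le> norm (1 + x ^ (2 * k))"
        by (simp add: power_mult[symmetric] mult.commute)
    qed
  qed simp
  \<comment> \<open>Clamping x to [-T, T] makes the power bounded. The error is at most
    \<open>D / T\<close> along the sequence and also for the limit, where only the inequality for
    the moment of order 2k + 2 is available; then T tends to infinity.\<close>
  have N_mom: "(\<integral>x. x ^ k \<partial>N) = s k" for k
  proof -
    define c where "c T x = (max (- T) (min T x)) ^ k" for T x :: real
    define D where "D = 2 * s (2 * k + 2)"
    have c_le: "\<bar>c T x\<bar> \<le> T ^ k" if "T \<ge> 1" for T x
      unfolding c_def power_abs by (rule power_mono) (use that in auto)
    have approx: "\<bar>(\<integral>x. x ^ k \<partial>Q) - (\<integral>x. c T x \<partial>Q)\<bar> \<le> 2 * (\<integral>x. x ^ (2 * k + 2) \<partial>Q) / T"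
      if "real_distribution Q" "\<And>j. integrable Q (\<lambda>x. x ^ j)" "T \<ge> 1" for Q T
    proof -
      interpret Q: real_distribution Q by fact
      have ci: "integrable Q (c T)"
      proof (rule Q.integrable_const_bound[of _ "T ^ k"])
        show "c T \<in> borel_measurable Q" unfolding c_def by measurable
      qed (use c_le[OF that(3)] in auto)
      have "\<bar>(\<integral>x. x ^ k \<partial>Q) - (\<integral>x. c T x \<partial>Q)\<bar> = \<bar>\<integral>x. x ^ k - c T x \<partial>Q\<bar>"
        using that(2) ci by simp
      also have "\<dots> \<le> (\<integral>x. \<bar>x ^ k - c T x\<bar> \<partial>Q)" by (rule integral_abs_bound)
      also have "\<dots> \<le> (\<integral>x. 2 * x ^ (2 * k + 2) / T \<partial>Q)"
      proof (rule integral_mono)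
        show "\<bar>x ^ k - c T x\<bar> \<le> 2 * x ^ (2 * k + 2) / T" for x
          unfolding c_def by (rule power_clamp_diff_le[OF that(3)])
        show "integrable Q (\<lambda>x. \<bar>x ^ k - c T x\<bar>)" using that(2)[of k] ci by simp
        show "integrable Q (\<lambda>x. 2 * x ^ (2 * k + 2) / T)" using that(2)[of "2 * k + 2"] by simp
      qed
      also have "\<dots> = 2 * (\<integral>x. x ^ (2 * k + 2) \<partial>Q) / T" by simp
      finally show ?thesis .
    qed
    have le: "\<bar>(\<integral>x. x ^ k \<partial>N) - s k\<bar> \<le> 2 * D / T" if T: "T \<ge> 1" for T
    proof -
      have "(\<lambda>n. \<integral>x. c T x \<partial>\<nu> (r n)) \<longlonglongrightarrow> (\<integral>x. c T x \<partial>N)"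
      proof (rule conv)
        show "isCont (c T) x" for x unfolding c_def by (intro continuous_intros)
        show "norm (c T x) \<le> T ^ k" for x using c_le[OF T] by simp
      qed
      then have "(\<lambda>n. \<bar>s k - (\<integral>x. c T x \<partial>\<nu> (r n))\<bar>) \<longlonglongrightarrow> \<bar>s k - (\<integral>x. c T x \<partial>N)\<bar>"
        by (intro tendsto_intros)
      then have "\<bar>s k - (\<integral>x. c T x \<partial>N)\<bar> \<le> D / T"
      proof (rule tendsto_upperbound)
        show "\<forall>\<^sub>F n in sequentially. \<bar>s k - (\<integral>x. c T x \<partial>\<nu> (r n))\<bar> \<le> D / T"
          using ev[of k] ev[of "2 * k + 2"]
        proof eventually_elim
          case (elim n)
          then show ?case using approx[OF rd int T, of "r n"] by (simp add: D_def)
        qed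
      qed simp
      moreover have "\<bar>(\<integral>x. x ^ k \<partial>N) - (\<integral>x. c T x \<partial>N)\<bar> \<le> D / T"
      proof -
        have "\<bar>(\<integral>x. x ^ k \<partial>N) - (\<integral>x. c T x \<partial>N)\<bar> \<le> 2 * (\<integral>x. x ^ (2 * (k + 1)) \<partial>N) / T"
          using approx[OF N N_int T] by simp
        also have "\<dots> \<le> D / T"
          using even_int[of "k + 1"] T by (auto simp: D_def intro!: divide_right_mono)
        finally show ?thesis .
      qed
      ultimately show ?thesis by linarith
    qed
    have "((\<lambda>T. 2 * D / T) \<longlongrightarrow> 0) at_top" by real_asymp
    then have "\<bar>(\<integral>x. x ^ k \<partial>N) - s k\<bar> \<le> 0"
      by (rule tendsto_lowerbound) (auto intro!: eventually_mono[OF eventually_ge_at_top[of 1]] le)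
    then show ?thesis by simp
  qed
  show ?thesis
    using that[OF r N _ N_int N_mom] conv by blast
qed

subsection \<open>Determinacy implies density\<close>

lemma finitely_supported_distribution:
  fixes w :: "real \<Rightarrow> real"
  assumes fin: "finite Z" and w: "\<And>z. z \<in> Z \<Longrightarrow> w z \<ge> 0" "(\<Sum>z\<in>Z. w z) = 1"
  obtains \<nu> where "real_distribution \<nu>"
    "\<And>f :: real \<Rightarrow> real. f \<in> borel_measurable borel \<Longrightarrow> integrable \<nu> f"
    "\<And>f :: real \<Rightarrow> real. f \<in> borel_measurable borel \<Longrightarrow> (\<integral>x. f x \<partial>\<nu>) = (\<Sum>z\<in>Z. w z * f z)"
proof -
  let ?D = "point_measure Z (\<lambda>z. ennreal (w z))"
  have meas: "(\<lambda>x. x) \<in> measurable ?D (borel :: real measure)" by simp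
  have "prob_space ?D"
  proof
    have "emeasure ?D Z = (\<Sum>z\<in>Z. ennreal (w z))" using fin by (simp add: emeasure_point_measure_finite)
    also have "\<dots> = 1" using w by (subst sum_ennreal) auto
    finally show "emeasure ?D (space ?D) = 1" by (simp add: space_point_measure)
  qed
  then have "real_distribution (distr ?D borel (\<lambda>x. x))"
    using meas by (rule prob_space.real_distribution_distr)
  moreover have "integrable (distr ?D borel (\<lambda>x. x)) f" if "f \<in> borel_measurable borel" for f :: "real \<Rightarrow> real"
    using that meas fin by (simp add: integrable_distr_eq integrable_point_measure_finite)
  moreover have "(\<integral>x. f x \<partial>distr ?D borel (\<lambda>x. x)) = (\<Sum>z\<in>Z. w z * f z)"
    if "f \<in> borel_measurable borel" for f :: "real \<Rightarrow> real"
    using that meas fin w by (simp add: integral_distr lebesgue_integral_point_measure_finite)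
  ultimately show ?thesis by (rule that)
qed

locale moment_measure =
  fixes M :: "real measure"
  assumes sets_eq [simp, measurable_cong]: "sets M = sets borel"
    and moments: "has_all_moments M"
begin

lemma space_eq [simp]: "space M = UNIV"
  using sets_eq_imp_space_eq[OF sets_eq] by simp

sublocale finite_measure M
proof
  have "integrable M (\<lambda>x. x ^ 0)" using moments by (simp only: has_all_moments_def)
  then show "emeasure M (space M) \<noteq> \<infinity>" by (simp add: integrable_iff_bounded less_top)
qed

lemma integrable_power [simp]: "integrable M (\<lambda>x. x ^ k)"
  using moments by (simp add: has_all_moments_def)

lemma integrable_poly [simp]: "integrable M (poly p)"
  by (subst poly_altdef[abs_def]) auto

lemma integrable_poly_mult [simp]: "integrable M (\<lambda>x. poly p x * poly r x)"
  using integrable_poly[of "p * r"] by (simp add: poly_mult[abs_def])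

lemma integrable_poly_square [simp]: "integrable M (\<lambda>x. (poly p x)\<^sup>2)"
  using integrable_poly_mult[of p p] by (simp add: power2_eq_square)

lemma measurable_poly [measurable]: "poly p \<in> borel_measurable M"
  using integrable_poly by (rule borel_measurable_integrable)

lemma integral_eq_sum_moments: "(\<integral>x. poly p x \<partial>M) = (\<Sum>i\<le>degree p. coeff p i * (\<integral>x. x ^ i \<partial>M))"
  by (subst poly_altdef[abs_def]) simp

lemma integrable_mult_square:
  assumes [measurable]: "f \<in> borel_measurable M" "g \<in> borel_measurable M"
    and "integrable M (\<lambda>x. (f x)\<^sup>2)" "integrable M (\<lambda>x. (g x)\<^sup>2)"
  shows "integrable M (\<lambda>x. f x * g x :: real)"
proof (rule Bochner_Integration.integrable_bound[of _ "\<lambda>x. (f x)\<^sup>2 + (g x)\<^sup>2"])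
  show "AE x in M. norm (f x * g x) \<le> norm ((f x)\<^sup>2 + (g x)\<^sup>2)"
  proof (rule AE_I2)
    fix x
    have "2 * \<bar>f x * g x\<bar> \<le> (f x)\<^sup>2 + (g x)\<^sup>2"
      using zero_le_power2[of "\<bar>f x\<bar> - \<bar>g x\<bar>"] by (simp add: power2_diff abs_mult)
    then show "norm (f x * g x) \<le> norm ((f x)\<^sup>2 + (g x)\<^sup>2)" by simp
  qed
qed (use assms in auto)

lemma integrable_square_add:
  assumes [measurable]: "f \<in> borel_measurable M" "g \<in> borel_measurable M"
    and "integrable M (\<lambda>x. (f x)\<^sup>2)" "integrable M (\<lambda>x. (g x)\<^sup>2)"
  shows "integrable M (\<lambda>x. (f x + g x :: real)\<^sup>2)"
  using integrable_mult_square[OF assms] assms(3,4) by (simp add: power2_sum mult.assoc)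

lemma integral_square_add_le:
  assumes [measurable]: "f \<in> borel_measurable M" "g \<in> borel_measurable M"
    and "integrable M (\<lambda>x. (f x)\<^sup>2)" "integrable M (\<lambda>x. (g x)\<^sup>2)"
  shows "(\<integral>x. (f x + g x :: real)\<^sup>2 \<partial>M) \<le> 2 * (\<integral>x. (f x)\<^sup>2 \<partial>M) + 2 * (\<integral>x. (g x)\<^sup>2 \<partial>M)"
proof -
  have "(\<integral>x. (f x + g x)\<^sup>2 \<partial>M) \<le> (\<integral>x. 2 * (f x)\<^sup>2 + 2 * (g x)\<^sup>2 \<partial>M)"
  proof (rule integral_mono)
    show "(f x + g x)\<^sup>2 \<le> 2 * (f x)\<^sup>2 + 2 * (g x)\<^sup>2" for x
      using zero_le_power2[of "f x - g x"] by (simp add: power2_sum power2_diff)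
  qed (use assms integrable_square_add in auto)
  then show ?thesis using assms by simp
qed

lemma L2_poly [simp]: "poly p \<in> L2 M"
  by (simp add: L2_def)

definition poly_approximable :: "(real \<Rightarrow> real) \<Rightarrow> bool" where
  "poly_approximable f \<longleftrightarrow> f \<in> L2 M \<and> (\<forall>\<epsilon>>0. \<exists>p. (\<integral>x. (f x - poly p x)\<^sup>2 \<partial>M) < \<epsilon>)"

text \<open>If the indicator of \<open>{x0}\<close> stays at distance \<open>\<epsilon>\<close> from the polynomials, then
  \<open>p \<mapsto> \<integral>p d\<mu> - \<rho> p(x0)\<close> is still positive on squares for a \<open>\<rho>\<close> exceeding the mass of \<open>x0\<close>.
  Adding the mass \<open>\<rho>\<close> at \<open>x0\<close> to its Gauss quadratures and passing to the limit gives a measure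
  with the moments of \<open>\<mu>\<close> but with too much mass at \<open>x0\<close>.\<close>
lemma determinate_imp_indicator_approximable:
  assumes det: "determinate M" and pos: "\<And>p. p \<noteq> 0 \<Longrightarrow> (\<integral>x. (poly p x)\<^sup>2 \<partial>M) > 0"
  shows "poly_approximable (indicator {x0})"
proof -
  have ind: "integrable M (indicator {x0} :: real \<Rightarrow> real)"
    by (simp add: integrable_indicator_iff emeasure_eq_measure)
  have sq: "(indicator {x0} x :: real)\<^sup>2 = indicator {x0} x" for x :: real
    by (simp add: indicator_def)
  have "\<exists>p. (\<integral>x. (indicator {x0} x - poly p x)\<^sup>2 \<partial>M) < \<epsilon>" if "\<epsilon> > 0" for \<epsilon>
  proof (rule ccontr)
    assume "\<not> ?thesis"
    then have far: "(\<integral>x. (indicator {x0} x - poly p x)\<^sup>2 \<partial>M) \<ge> \<epsilon>" for p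
      by (auto simp: not_less)
    define a where "a = measure M {x0}"
    have a0: "a \<ge> 0" by (simp add: a_def)
    \<comment> \<open>Scaling p to value 1 at \<open>x0\<close> makes the mixed term explicit: the
      squared distance to the indicator is the squared norm minus the mass a.\<close>
    have lower: "(a + \<epsilon>) * (poly p x0)\<^sup>2 \<le> (\<integral>x. (poly p x)\<^sup>2 \<partial>M)" for p
    proof (cases "poly p x0 = 0")
      case False
      define r where "r = smult (1 / poly p x0) p"
      have "(indicator {x0} x - poly r x)\<^sup>2 = (poly r x)\<^sup>2 - indicator {x0} x" for x
        using False by (simp add: indicator_def power2_eq_square r_def)
      then have "(\<integral>x. (indicator {x0} x - poly r x)\<^sup>2 \<partial>M) = (\<integral>x. (poly r x)\<^sup>2 \<partial>M) - a"
        using ind by (simp add: a_def)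
      then have "(\<integral>x. (poly r x)\<^sup>2 \<partial>M) \<ge> a + \<epsilon>" using far[of r] by simp
      moreover have "(\<integral>x. (poly r x)\<^sup>2 \<partial>M) = (\<integral>x. (poly p x)\<^sup>2 \<partial>M) / (poly p x0)\<^sup>2"
        by (simp add: r_def power_divide power_mult_distrib)
      ultimately show ?thesis using False by (simp add: field_simps)
    qed simp
    \<comment> \<open>Any value strictly between a and a + \<epsilon> works: above a for the final
      contradiction, below a + \<epsilon> so that \<open>L\<close> stays strictly positive on
      squares.\<close>
    define \<rho> where "\<rho> = a + \<epsilon> / 2"
    have \<rho>: "\<rho> > a" "\<rho> < a + \<epsilon>" "\<rho> > 0" using \<open>\<epsilon> > 0\<close> a0 by (auto simp: \<rho>_def)
    define L where "L p = (\<integral>x. poly p x \<partial>M) - \<rho> * poly p x0" for p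
    interpret L: positive_poly_functional L
    proof
      fix p :: "real poly" assume "p \<noteq> 0"
      have "\<rho> * (poly p x0)\<^sup>2 < (\<integral>x. (poly p x)\<^sup>2 \<partial>M)"
      proof (cases "poly p x0 = 0")
        case True then show ?thesis using pos[OF \<open>p \<noteq> 0\<close>] by simp
      next
        case False
        then have "\<rho> * (poly p x0)\<^sup>2 < (a + \<epsilon>) * (poly p x0)\<^sup>2"
          using \<rho> by (intro mult_strict_right_mono) auto
        then show ?thesis using lower[of p] by linarith
      qed
      then show "0 < L (p * p)" by (simp add: L_def power2_eq_square)
    qed (simp_all add: L_def algebra_simps)
    \<comment> \<open>Tightness and the selection of a subsequence are about probability measures,
      so all masses are divided by the total mass until the limit is found.\<close>
    define m where "m = measure M UNIV"
    have m: "m > 0" using pos[of 1] by (simp add: m_def)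
    define G where "G n \<nu> Z w \<longleftrightarrow>
        real_distribution \<nu> \<and> finite Z \<and> x0 \<in> Z \<and> (\<forall>z\<in>Z. w z \<ge> 0) \<and> w x0 \<ge> \<rho> / m \<and>
        (\<forall>f :: real \<Rightarrow> real. f \<in> borel_measurable borel \<longrightarrow> integrable \<nu> f) \<and>
        (\<forall>f :: real \<Rightarrow> real. f \<in> borel_measurable borel \<longrightarrow> (\<integral>x. f x \<partial>\<nu>) = (\<Sum>z\<in>Z. w z * f z)) \<and>
        (\<forall>k \<le> n + 2. (\<integral>x. x ^ k \<partial>\<nu>) = (\<integral>x. x ^ k \<partial>M) / m)" for n :: nat and \<nu> :: "real measure" and Z w
    have "\<exists>\<nu> Z w. G n \<nu> Z w" for n
    proof -
      \<comment> \<open>Quadrature of order n + 2 is exact below degree 2n + 4, which covers the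
        moments up to n + 2.\<close>
      obtain Z0 w0 where Z0: "finite Z0" "\<forall>z\<in>Z0. w0 z \<ge> 0"
        and quad: "\<And>p. degree p < 2 * (n + 2) \<Longrightarrow> L p = (\<Sum>z\<in>Z0. w0 z * poly p z)"
        using L.gauss_quadrature[of "n + 2"] by blast
      define Z where "Z = insert x0 Z0"
      \<comment> \<open>\<open>x0\<close> may already be a quadrature node, so the two contributions
        are added.\<close>
      define w where "w z = ((if z \<in> Z0 then w0 z else 0) + (if z = x0 then \<rho> else 0)) / m" for z
      have Zfin: "finite Z" using Z0 by (simp add: Z_def)
      have w0: "w z \<ge> 0" for z using Z0(2) m \<rho>(3) by (auto simp: w_def)
      have wx0: "w x0 \<ge> \<rho> / m" using Z0(2) m by (auto simp: w_def divide_right_mono)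
      have sumw: "(\<Sum>z\<in>Z. w z * poly p z) = (\<integral>x. poly p x \<partial>M) / m" if "degree p < 2 * (n + 2)" for p
      proof -
        have "(\<Sum>z\<in>Z. w z * poly p z) = 
            ((\<Sum>z\<in>Z. if z \<in> Z0 then w0 z * poly p z else 0) + (\<Sum>z\<in>Z. if z = x0 then \<rho> * poly p z else 0)) / m"
          unfolding sum.distrib[symmetric] sum_divide_distrib
          by (intro sum.cong) (auto simp: w_def field_simps)
        also have "(\<Sum>z\<in>Z. if z \<in> Z0 then w0 z * poly p z else 0) = (\<Sum>z\<in>Z0. w0 z * poly p z)"
          using Zfin by (intro sum.mono_neutral_cong_right) (auto simp: Z_def)
        also have "(\<Sum>z\<in>Z. if z = x0 then \<rho> * poly p z else 0) = \<rho> * poly p x0"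
          using Zfin by (simp add: Z_def)
        finally show ?thesis using quad[OF that] by (simp add: L_def)
      qed
      have "(\<Sum>z\<in>Z. w z) = 1"
        using sumw[of 1] m by (simp add: m_def)
      then obtain \<nu> where \<nu>: "real_distribution \<nu>"
        "\<And>f :: real \<Rightarrow> real. f \<in> borel_measurable borel \<Longrightarrow> integrable \<nu> f"
        "\<And>f :: real \<Rightarrow> real. f \<in> borel_measurable borel \<Longrightarrow> (\<integral>x. f x \<partial>\<nu>) = (\<Sum>z\<in>Z. w z * f z)"
        using finitely_supported_distribution[of Z w] Zfin w0 by metis
      have "(\<integral>x. x ^ k \<partial>\<nu>) = (\<integral>x. x ^ k \<partial>M) / m" if "k \<le> n + 2" for k
        using \<nu>(3)[of "\<lambda>x. x ^ k"] sumw[of "monom 1 k"] that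
        by (simp add: poly_monom degree_monom_eq)
      note mom = this
      have "G n \<nu> Z w"
        unfolding G_def
      proof (intro conjI allI impI ballI)
        show "real_distribution \<nu>" by (rule \<nu>(1))
        show "finite Z" by (rule Zfin)
        show "x0 \<in> Z" by (simp add: Z_def)
        show "w z \<ge> 0" for z by (rule w0)
        show "w x0 \<ge> \<rho> / m" by (rule wx0)
      qed (rule \<nu> mom, assumption)+
      then show ?thesis by blast
    qed
    then obtain \<nu> Z w where G: "\<And>n. G n (\<nu> n) (Z n) (w n)" by metis
    have \<nu>: "real_distribution (\<nu> n)" "finite (Z n)" "x0 \<in> Z n" "w n x0 \<ge> \<rho> / m" for n
      using G[of n] unfolding G_def by simp_all
    have w_nonneg: "w n z \<ge> 0" if "z \<in> Z n" for n z
      using G[of n] that unfolding G_def by simp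
    have int: "integrable (\<nu> n) f" if "f \<in> borel_measurable borel" for n and f :: "real \<Rightarrow> real"
      using G[of n] that unfolding G_def by simp
    have integral: "(\<integral>x. f x \<partial>\<nu> n) = (\<Sum>z\<in>Z n. w n z * f z)"
      if "f \<in> borel_measurable borel" for n and f :: "real \<Rightarrow> real"
      using G[of n] that unfolding G_def by simp
    have mom: "(\<integral>x. x ^ k \<partial>\<nu> n) = (\<integral>x. x ^ k \<partial>M) / m" if "k \<le> n + 2" for n k
      using G[of n] that unfolding G_def by blast
    have int': "integrable (\<nu> n) (\<lambda>x. x ^ k)" for n k by (rule int) simp
    obtain r N where "strict_mono (r :: nat \<Rightarrow> nat)" and N: "real_distribution N"
      and conv_all: "\<forall>(f :: real \<Rightarrow> real) B. (\<forall>x. isCont f x) \<longrightarrow> (\<forall>x. norm (f x) \<le> B) \<longrightarrow>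
         (\<lambda>n. \<integral>x. f x \<partial>\<nu> (r n)) \<longlonglongrightarrow> (\<integral>x. f x \<partial>N)"
      and N_int: "\<And>k. integrable N (\<lambda>x. x ^ k)"
      and N_mom: "\<And>k. (\<integral>x. x ^ k \<partial>N) = (\<integral>x. x ^ k \<partial>M) / m"
      using moment_convergent_subsequence[where \<nu>=\<nu> and s="\<lambda>k. (\<integral>x. x ^ k \<partial>M) / m", OF \<nu>(1) int' mom]
      by blast
    have conv: "(\<lambda>n. \<integral>x. f x \<partial>\<nu> (r n)) \<longlonglongrightarrow> (\<integral>x. f x \<partial>N)"
      if "\<And>x. isCont f x" "\<And>x. norm (f x) \<le> B" for f :: "real \<Rightarrow> real" and B
      using conv_all that by blast
    interpret N: real_distribution N by fact
    \<comment> \<open>Undoing the normalisation gives a measure with the moments of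
      \<open>M\<close>, to which determinacy applies.\<close>
    have "density N (\<lambda>_. ennreal m) = M"
    proof -
      have "has_all_moments (density N (\<lambda>_. ennreal m))"
        unfolding has_all_moments_def
        using m N_int by (subst integrable_density) auto
      moreover have "(\<integral>x. x ^ k \<partial>density N (\<lambda>_. ennreal m)) = (\<integral>x. x ^ k \<partial>M)" for k
        using m N_mom[of k] by (subst integral_density) auto
      ultimately show ?thesis using det unfolding determinate_def by simp
    qed
    note dens = this
    have scale: "(\<integral>x. f x \<partial>M) = m * (\<integral>x. f x \<partial>N)" if "f \<in> borel_measurable borel" for f :: "real \<Rightarrow> real"
      using m that by (subst dens[symmetric], subst integral_density) auto
    \<comment> \<open>Continuous tents shrinking to the indicator of \<open>x0\<close>: each has
      integral at least \<open>\<rho> / m\<close> along the sequence because of the node at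
      \<open>x0\<close>, this bound passes to the weak limit, and dominated convergence then returns
      to the point mass.\<close>
    define b where "b j x = max 0 (1 - real j * \<bar>x - x0\<bar>)" for j :: nat and x
    have b: "0 \<le> b j x" "b j x \<le> 1" "b j x0 = 1" "b j \<in> borel_measurable borel" for j x
      by (auto simp: b_def[abs_def])
    have "(\<integral>x. b j x \<partial>M) \<ge> \<rho>" for j
    proof -
      have "(\<integral>x. b j x \<partial>N) \<ge> \<rho> / m"
      proof (rule tendsto_lowerbound[OF conv])
        show "isCont (b j) x" for x unfolding b_def by (intro continuous_intros)
        show "norm (b j x) \<le> 1" for x using b(1,2)[of j x] by simp
        show "\<forall>\<^sub>F n in sequentially. \<rho> / m \<le> (\<integral>x. b j x \<partial>\<nu> (r n))"
        proof (intro always_eventually allI)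
          fix n
          have "\<rho> / m \<le> w (r n) x0 * b j x0" using \<nu>(4) b by simp
          also have "\<dots> \<le> (\<Sum>z\<in>Z (r n). w (r n) z * b j z)"
            using \<nu> w_nonneg b by (intro member_le_sum) auto
          also have "\<dots> = (\<integral>x. b j x \<partial>\<nu> (r n))" using integral[OF b(4)] by simp
          finally show "\<rho> / m \<le> (\<integral>x. b j x \<partial>\<nu> (r n))" .
        qed
      qed simp
      then show ?thesis using m scale[OF b(4), of j] by (simp add: field_simps)
    qed
    moreover have "(\<lambda>j. \<integral>x. b j x \<partial>M) \<longlonglongrightarrow> (\<integral>x. indicator {x0} x \<partial>M)"
    proof (rule integral_dominated_convergence[where w="\<lambda>_. 1"])
      show "AE x in M. (\<lambda>j. b j x) \<longlonglongrightarrow> indicator {x0} x"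
      proof (rule AE_I2)
        fix x
        show "(\<lambda>j. b j x) \<longlonglongrightarrow> indicator {x0} x"
        proof (cases "x = x0")
          case False
          show ?thesis
          proof (rule tendsto_eventually)
            show "\<forall>\<^sub>F j in sequentially. b j x = indicator {x0} x"
              using eventually_ge_at_top[of "nat \<lceil>1 / \<bar>x - x0\<bar>\<rceil>"]
            proof eventually_elim
              case (elim j)
              then have "1 / \<bar>x - x0\<bar> \<le> real j" by linarith
              then have "1 \<le> real j * \<bar>x - x0\<bar>" using False by (simp add: field_simps)
              then show ?case using False by (simp add: b_def)
            qed
          qed
        qed (simp add: b_def)
      qed
    qed (use b in auto)
    ultimately have "\<rho> \<le> (\<integral>x. indicator {x0} x \<partial>M)"
      by (intro LIMSEQ_le_const) auto
    then show False using \<rho> by (simp add: a_def)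
  qed
  then show ?thesis using ind by (simp add: poly_approximable_def L2_def sq)
qed

section \<open>Density of polynomials for a purely atomic measure\<close>

lemma poly_approximable_add:
  assumes "poly_approximable f" "poly_approximable g"
  shows "poly_approximable (\<lambda>x. f x + g x)"
  unfolding poly_approximable_def
proof (intro conjI allI impI)
  have [measurable]: "f \<in> borel_measurable M" "g \<in> borel_measurable M"
    and int: "integrable M (\<lambda>x. (f x)\<^sup>2)" "integrable M (\<lambda>x. (g x)\<^sup>2)"
    using assms by (auto simp: poly_approximable_def L2_def)
  show "(\<lambda>x. f x + g x) \<in> L2 M"
    using integrable_square_add[OF _ _ int] by (simp add: L2_def)
  fix \<epsilon> :: real assume "\<epsilon> > 0"
  \<comment> \<open>A quarter for each summand, because the square of a sum is bounded by twice the
    sum of the squares.\<close>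
  then have "\<epsilon> / 4 > 0" by simp
  then obtain p r where p: "(\<integral>x. (f x - poly p x)\<^sup>2 \<partial>M) < \<epsilon> / 4" and r: "(\<integral>x. (g x - poly r x)\<^sup>2 \<partial>M) < \<epsilon> / 4"
    using assms unfolding poly_approximable_def by metis
  have i: "integrable M (\<lambda>x. (f x - poly p x)\<^sup>2)" "integrable M (\<lambda>x. (g x - poly r x)\<^sup>2)"
    using integrable_square_add[of f "poly (- p)"] integrable_square_add[of g "poly (- r)"] int by auto
  have "(\<integral>x. ((f x + g x) - poly (p + r) x)\<^sup>2 \<partial>M) = (\<integral>x. ((f x - poly p x) + (g x - poly r x))\<^sup>2 \<partial>M)"
    by (simp add: algebra_simps)
  also have "\<dots> \<le> 2 * (\<integral>x. (f x - poly p x)\<^sup>2 \<partial>M) + 2 * (\<integral>x. (g x - poly r x)\<^sup>2 \<partial>M)"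
    by (rule integral_square_add_le) (use i in auto)
  also have "\<dots> < \<epsilon>" using p r by linarith
  finally show "\<exists>p. (\<integral>x. ((f x + g x) - poly p x)\<^sup>2 \<partial>M) < \<epsilon>" by blast
qed

lemma poly_approximable_scale:
  assumes "poly_approximable f"
  shows "poly_approximable (\<lambda>x. c * f x)"
  unfolding poly_approximable_def
proof (intro conjI allI impI)
  have [measurable]: "f \<in> borel_measurable M" and int: "integrable M (\<lambda>x. (f x)\<^sup>2)"
    using assms by (auto simp: poly_approximable_def L2_def)
  then show "(\<lambda>x. c * f x) \<in> L2 M"
    by (simp add: L2_def power_mult_distrib)
  fix \<epsilon> :: real assume "\<epsilon> > 0"
  then have "\<epsilon> / (c\<^sup>2 + 1) > 0" by (simp add: add_nonneg_pos)
  then obtain p where p: "(\<integral>x. (f x - poly p x)\<^sup>2 \<partial>M) < \<epsilon> / (c\<^sup>2 + 1)"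
    using assms unfolding poly_approximable_def by metis
  have "(\<integral>x. (c * f x - poly (smult c p) x)\<^sup>2 \<partial>M) = (\<integral>x. c\<^sup>2 * (f x - poly p x)\<^sup>2 \<partial>M)"
    by (simp add: power_mult_distrib[symmetric] algebra_simps)
  also have "\<dots> = c\<^sup>2 * (\<integral>x. (f x - poly p x)\<^sup>2 \<partial>M)" by simp
  also have "\<dots> \<le> (c\<^sup>2 + 1) * (\<integral>x. (f x - poly p x)\<^sup>2 \<partial>M)"
    by (intro mult_right_mono) auto
  also have "\<dots> < \<epsilon>" using p pos_less_divide_eq[of "c\<^sup>2 + 1"]
    by (simp add: add_nonneg_pos mult.commute)
  finally show "\<exists>p. (\<integral>x. (c * f x - poly p x)\<^sup>2 \<partial>M) < \<epsilon>" by blast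
qed

lemma poly_approximable_zero: "poly_approximable (\<lambda>_. 0)"
  unfolding poly_approximable_def by (auto simp: L2_def intro!: exI[of _ 0])

text \<open>Restricting f to the first atoms of an enumeration of X gives finite combinations of
  indicators, and by dominated convergence these restrictions tend to f in the L2 norm.\<close>

lemma poly_approximable_purely_atomic:
  assumes X: "countable X" "AE x in M. x \<in> X"
    and ind: "\<And>x. x \<in> X \<Longrightarrow> poly_approximable (indicator {x})"
    and f: "f \<in> L2 M"
  shows "poly_approximable f"
  unfolding poly_approximable_def
proof (intro conjI allI impI f)
  have fm [measurable]: "f \<in> borel_measurable M" and f2: "integrable M (\<lambda>x. (f x)\<^sup>2)"
    using f by (auto simp: L2_def)
  fix \<epsilon> :: real assume "\<epsilon> > 0"
  define F where "F n = {x \<in> X. to_nat_on X x \<le> n}" for n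
  have Ffin: "finite (F n)" for n
  proof (rule finite_imageD)
    show "finite (to_nat_on X ` F n)" by (rule finite_subset[of _ "{..n}"]) (auto simp: F_def)
    show "inj_on (to_nat_on X) (F n)"
      using inj_on_to_nat_on[OF X(1)] by (rule inj_on_subset) (auto simp: F_def)
  qed
  have [measurable]: "F n \<in> sets M" for n using Ffin[of n] by (simp add: finite_imp_closed borel_closed)
  have approx: "poly_approximable (\<lambda>x. f x * indicator (F n) x)" for n
  proof -
    have fin_sum: "poly_approximable (\<lambda>x. \<Sum>y\<in>A. f y * indicator {y} x)" if "finite A" "A \<subseteq> X" for A
      using that
    proof (induction A rule: finite_induct)
      case (insert y A)
      have "poly_approximable (\<lambda>x. f y * indicator {y} x + (\<Sum>y\<in>A. f y * indicator {y} x))"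
        using insert.prems insert.IH
        by (intro poly_approximable_add poly_approximable_scale ind) auto
      then show ?case unfolding sum.insert[OF insert.hyps] .
    qed (simp add: poly_approximable_zero)
    have eq: "(\<lambda>x. \<Sum>y\<in>F n. f y * indicator {y} x) = (\<lambda>x. f x * indicator (F n) x)"
      using Ffin[of n] by (auto simp: fun_eq_iff indicator_def if_distrib cong: if_cong)
    show ?thesis unfolding eq[symmetric] by (rule fin_sum[OF Ffin]) (auto simp: F_def)
  qed
  have "(\<lambda>n. \<integral>x. (f x - f x * indicator (F n) x)\<^sup>2 \<partial>M) \<longlonglongrightarrow> (\<integral>x. 0 \<partial>M)"
  proof (rule integral_dominated_convergence[where w="\<lambda>x. (f x)\<^sup>2"])
    show "AE x in M. (\<lambda>n. (f x - f x * indicator (F n) x)\<^sup>2) \<longlonglongrightarrow> 0"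
      using X(2)
    proof eventually_elim
      case (elim x)
      show ?case
      proof (rule tendsto_eventually)
        show "\<forall>\<^sub>F n in sequentially. (f x - f x * indicator (F n) x)\<^sup>2 = 0"
          using eventually_ge_at_top[of "to_nat_on X x"]
          by eventually_elim (use elim in \<open>auto simp: F_def\<close>)
      qed
    qed
    show "AE x in M. norm ((f x - f x * indicator (F n) x)\<^sup>2) \<le> (f x)\<^sup>2" for n
      by (auto simp: indicator_def)
  qed (use f2 in auto)
  then have "\<forall>\<^sub>F n in sequentially. (\<integral>x. (f x - f x * indicator (F n) x)\<^sup>2 \<partial>M) < \<epsilon> / 4"
    using \<open>\<epsilon> > 0\<close> by (intro order_tendstoD) auto
  then obtain n where n: "(\<integral>x. (f x - f x * indicator (F n) x)\<^sup>2 \<partial>M) < \<epsilon> / 4"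
    by (auto simp: eventually_sequentially)
  let ?g = "\<lambda>x. f x * indicator (F n) x"
  have "\<epsilon> / 4 > 0" using \<open>\<epsilon> > 0\<close> by simp
  then obtain p where p: "(\<integral>x. (?g x - poly p x)\<^sup>2 \<partial>M) < \<epsilon> / 4"
    using approx[of n] unfolding poly_approximable_def by metis
  have g2: "integrable M (\<lambda>x. (?g x)\<^sup>2)" using approx[of n] by (simp add: poly_approximable_def L2_def)
  have i: "integrable M (\<lambda>x. (f x - ?g x)\<^sup>2)" "integrable M (\<lambda>x. (?g x - poly p x)\<^sup>2)"
    using integrable_square_add[of f "\<lambda>x. - ?g x"] integrable_square_add[of ?g "poly (- p)"] f2 g2 by auto
  have "(\<integral>x. (f x - poly p x)\<^sup>2 \<partial>M) = (\<integral>x. ((f x - ?g x) + (?g x - poly p x))\<^sup>2 \<partial>M)"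
    by simp
  also have "\<dots> \<le> 2 * (\<integral>x. (f x - ?g x)\<^sup>2 \<partial>M) + 2 * (\<integral>x. (?g x - poly p x)\<^sup>2 \<partial>M)"
    by (rule integral_square_add_le) (use i in auto)
  also have "\<dots> < \<epsilon>" using n p by linarith
  finally show "\<exists>p. (\<integral>x. (f x - poly p x)\<^sup>2 \<partial>M) < \<epsilon>" by blast
qed

end

subsection \<open>Bounded point evaluations of an indeterminate measure\<close>

text \<open>Nothing says in advance that \<open>N\<close> is carried by \<open>X\<close>. Equal
  point masses give \<open>X\<close> the same mass under both measures, which is the whole mass of
  \<open>M\<close> and therefore of \<open>N\<close>, so nothing of \<open>N\<close> is left
  outside.\<close>

lemma measure_eqI_countable_support:
  fixes M N :: "real measure"
  assumes "finite_measure M" "finite_measure N" and sets: "sets M = sets borel" "sets N = sets borel"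
    and X: "countable X" "AE x in M. x \<in> X"
    and total: "measure N UNIV = measure M UNIV"
    and pts: "\<And>x. x \<in> X \<Longrightarrow> measure N {x} = measure M {x}"
  shows "N = M"
proof (rule measure_eqI)
  interpret M: finite_measure M by fact
  interpret N: finite_measure N by fact
  note [simp, measurable_cong] = sets
  have [simp]: "space M = UNIV" "space N = UNIV"
    using sets[THEN sets_eq_imp_space_eq] by simp_all
  have cm: "C \<in> sets borel" if "C \<subseteq> X" for C
    using countable_subset[OF that X(1)] by (rule sets.countable[rotated]) auto
  have eqX: "emeasure N C = emeasure M C" if C: "C \<subseteq> X" for C
  proof -
    have "countable C" using C X(1) by (rule countable_subset)
    then have "emeasure N C = (\<integral>\<^sup>+x. emeasure N {x} \<partial>count_space C)"
      "emeasure M C = (\<integral>\<^sup>+x. emeasure M {x} \<partial>count_space C)"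
      by (intro emeasure_countable_singleton; simp)+
    moreover have "emeasure N {x} = emeasure M {x}" if "x \<in> C" for x
      using pts[of x] that C by (auto simp: N.emeasure_eq_measure M.emeasure_eq_measure)
    ultimately show ?thesis by (auto intro!: nn_integral_cong)
  qed
  have "emeasure M X = emeasure M UNIV"
    using X(2) cm[of X] by (intro emeasure_eq_AE) auto
  then have "measure N X = measure N UNIV"
    using eqX[of X] total by (simp add: Sigma_Algebra.measure_def)
  then have "measure N (UNIV - X) = 0"
    using N.finite_measure_compl[of X] cm[of X] by simp
  then have AEN: "AE x in N. x \<in> X"
    using cm[of X] by (intro AE_I[of _ _ "UNIV - X"]) (auto simp: N.emeasure_eq_measure)
  fix A assume "A \<in> sets N"
  then have A: "A \<in> sets borel" by simp
  have "emeasure N A = emeasure N (A \<inter> X)"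
    using AEN A cm[of "A \<inter> X"] by (intro emeasure_eq_AE) auto
  also have "\<dots> = emeasure M (A \<inter> X)" by (rule eqX) simp
  also have "\<dots> = emeasure M A"
    using X(2) A cm[of "A \<inter> X"] by (intro emeasure_eq_AE) auto
  finally show "emeasure N A = emeasure M A" .
qed (use sets in simp)

lemma norm_of_real_minus_ge_Im: "norm (complex_of_real x - z) \<ge> \<bar>Im z\<bar>"
  using abs_Im_le_cmod[of "complex_of_real x - z"] by simp

text \<open>With y = 1 / (j + 1), the factor -iy / (x - a - iy) equals 1 at x = a, tends to 0
  elsewhere and has modulus at most 1, so dominated convergence applies.\<close>

lemma point_mass_from_stieltjes:
  fixes N :: "real measure"
  assumes "finite_measure N" and sets: "sets N = sets borel"
  shows "(\<lambda>j. - \<i> * of_real (1 / real (Suc j)) *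
           (\<integral>x. 1 / (complex_of_real x - Complex a (1 / real (Suc j))) \<partial>N)) \<longlonglongrightarrow> of_real (measure N {a})"
proof -
  interpret finite_measure N by fact
  note [simp, measurable_cong] = sets
  define k where "k j x = - \<i> * of_real (1 / real (Suc j)) * (1 / (complex_of_real x - Complex a (1 / real (Suc j))))" for j x
  have "(\<lambda>j. \<integral>x. k j x \<partial>N) \<longlonglongrightarrow> (\<integral>x. of_real (indicator {a} x) \<partial>N)"
  proof (rule integral_dominated_convergence[where w="\<lambda>_. 1"])
    show "k j \<in> borel_measurable N" for j unfolding k_def by measurable
    show "AE x in N. norm (k j x) \<le> 1" for j
    proof (rule AE_I2)
      fix x
      have "1 / real (Suc j) \<le> norm (complex_of_real x - Complex a (1 / real (Suc j)))"
        using norm_of_real_minus_ge_Im[of "Complex a (1 / real (Suc j))" x] by simp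
      moreover have "1 / real (Suc j) > 0" by simp
      ultimately have "(1 / real (Suc j)) / norm (complex_of_real x - Complex a (1 / real (Suc j))) \<le> 1"
        by (intro divide_le_eq_1[THEN iffD2]) linarith
      then show "norm (k j x) \<le> 1" by (simp add: k_def norm_mult norm_divide del: of_nat_Suc)
    qed
    show "AE x in N. (\<lambda>j. k j x) \<longlonglongrightarrow> of_real (indicator {a} x)"
    proof (rule AE_I2)
      fix x
      show "(\<lambda>j. k j x) \<longlonglongrightarrow> of_real (indicator {a} x)"
      proof (cases "x = a")
        case True
        have "complex_of_real a - Complex a y = - \<i> * of_real y" for y
          by (simp add: complex_eq_iff)
        then have "k j x = 1" for j using True by (simp add: k_def del: of_nat_Suc)
        then show ?thesis using True by simp
      next
        case False
        have y: "(\<lambda>j. 1 / real (Suc j)) \<longlonglongrightarrow> 0" using LIMSEQ_inverse_real_of_nat by (simp add: inverse_eq_divide)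
        have c: "Complex a y = of_real a + \<i> * of_real y" for y by (simp add: complex_eq_iff)
        have "(\<lambda>j. k j x) \<longlonglongrightarrow> - \<i> * of_real 0 * (1 / (complex_of_real x - (of_real a + \<i> * of_real 0)))"
          unfolding k_def c using False by (intro tendsto_intros y) auto
        then show ?thesis using False by simp
      qed
    qed
  qed auto
  moreover have "(\<integral>x. k j x \<partial>N) = - \<i> * of_real (1 / real (Suc j)) *
      (\<integral>x. 1 / (complex_of_real x - Complex a (1 / real (Suc j))) \<partial>N)" for j
    unfolding k_def by (rule integral_mult_right_zero)
  moreover have "(\<integral>x. of_real (indicator {a} x) \<partial>N) = complex_of_real (measure N {a})"
    by simp
  ultimately show ?thesis by simp
qed

text \<open>A measure carried by a countable set is determined by its Stieltjes transform,
  since the latter recovers all point masses.\<close>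
lemma stieltjes_transform_differs:
  fixes M N :: "real measure"
  assumes fin: "finite_measure M" "finite_measure N" and sets: "sets M = sets borel" "sets N = sets borel"
    and X: "countable X" "AE x in M. x \<in> X"
    and total: "measure N UNIV = measure M UNIV" and "N \<noteq> M"
  obtains z where "Im z > 0" "(\<integral>x. 1 / (complex_of_real x - z) \<partial>M) \<noteq> (\<integral>x. 1 / (complex_of_real x - z) \<partial>N)"
proof -
  obtain a where a: "measure N {a} \<noteq> measure M {a}"
    using measure_eqI_countable_support[OF fin sets X total] \<open>N \<noteq> M\<close> by blast
  have "\<exists>j. (\<integral>x. 1 / (complex_of_real x - Complex a (1 / real (Suc j))) \<partial>M) \<noteq>
      (\<integral>x. 1 / (complex_of_real x - Complex a (1 / real (Suc j))) \<partial>N)"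
  proof (rule ccontr)
    assume "\<not> ?thesis"
    then have "complex_of_real (measure N {a}) = of_real (measure M {a})"
      using LIMSEQ_unique[OF point_mass_from_stieltjes[OF fin(1) sets(1), of a]]
        point_mass_from_stieltjes[OF fin(2) sets(2), of a] by simp
    then show False using a by simp
  qed
  then obtain j where "(\<integral>x. 1 / (complex_of_real x - Complex a (1 / real (Suc j))) \<partial>M) \<noteq>
      (\<integral>x. 1 / (complex_of_real x - Complex a (1 / real (Suc j))) \<partial>N)" ..
  then show ?thesis by (rule that[rotated]) simp
qed

text \<open>The parts are taken coefficientwise, so the decomposition holds at every complex z and
  not only on the real line.\<close>

lemma complex_poly_parts:
  obtains u v where "degree u \<le> degree c" "degree v \<le> degree c"
    "\<And>z. poly c z = cpoly u z + \<i> * cpoly v z"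
proof
  show "degree (map_poly Re c) \<le> degree c" "degree (map_poly Im c) \<le> degree c"
    by (simp_all add: map_poly_degree_leq)
  have "c = map_poly complex_of_real (map_poly Re c) + smult \<i> (map_poly complex_of_real (map_poly Im c))"
    by (intro poly_eqI) (simp add: coeff_map_poly complex_eq_iff)
  note c = this
  have "poly c z = poly (map_poly complex_of_real (map_poly Re c) +
      smult \<i> (map_poly complex_of_real (map_poly Im c))) z" for z
    by (simp only: c[symmetric])
  then show "poly c z = cpoly (map_poly Re c) z + \<i> * cpoly (map_poly Im c) z" for z by simp
qed

lemma poly_difference_quotient:
  fixes c :: "'a::field poly"
  obtains r where "\<And>w. poly c w = poly c z + (w - z) * poly r w" "degree r \<le> degree c"
proof -
  have "[:-z, 1:] dvd c - [:poly c z:]" by (simp add: poly_eq_0_iff_dvd[symmetric])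
  then obtain r where r: "c - [:poly c z:] = [:-z, 1:] * r" by (auto simp: dvd_def)
  have 1: "poly c w = poly c z + (w - z) * poly r w" for w
  proof -
    have "poly (c - [:poly c z:]) w = poly ([:-z, 1:] * r) w" by (simp only: r)
    then show ?thesis by (simp add: algebra_simps)
  qed
  have "degree r \<le> degree c"
  proof (cases "r = 0")
    case False
    then have "degree r \<le> degree ([:-z, 1:] * r)" by (subst degree_mult_eq) auto
    also have "\<dots> \<le> degree c" unfolding r[symmetric] by (intro degree_diff_le) auto
    finally show ?thesis .
  qed simp
  with 1 show ?thesis by (rule that)
qed

context moment_measure
begin

text \<open>A nonnegative quadratic in t, evaluated at its minimum \<open>I / A\<close>. If A = 0 it
  is affine in t, and for nonzero I the chosen t would give it the value -1.\<close>

lemma Cauchy_Schwarz_integral: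
  fixes f g :: "real \<Rightarrow> real"
  assumes [measurable]: "f \<in> borel_measurable M" "g \<in> borel_measurable M"
    and int: "integrable M (\<lambda>x. (f x)\<^sup>2)" "integrable M (\<lambda>x. (g x)\<^sup>2)"
  shows "(\<integral>x. \<bar>f x * g x\<bar> \<partial>M) \<le> sqrt (\<integral>x. (f x)\<^sup>2 \<partial>M) * sqrt (\<integral>x. (g x)\<^sup>2 \<partial>M)"
proof -
  define A where "A = (\<integral>x. (f x)\<^sup>2 \<partial>M)"
  define B where "B = (\<integral>x. (g x)\<^sup>2 \<partial>M)"
  define I where "I = (\<integral>x. \<bar>f x * g x\<bar> \<partial>M)"
  have nn: "A \<ge> 0" "B \<ge> 0" "I \<ge> 0" by (auto simp: A_def B_def I_def)
  have fg: "integrable M (\<lambda>x. \<bar>f x * g x\<bar>)"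
    using integrable_mult_square[OF assms] by simp
  have quad: "0 \<le> A * t\<^sup>2 - 2 * t * I + B" for t
  proof -
    have "0 \<le> (\<integral>x. (\<bar>f x\<bar> * t - \<bar>g x\<bar>)\<^sup>2 \<partial>M)" by simp
    also have "\<dots> = (\<integral>x. (f x)\<^sup>2 * t\<^sup>2 - (2 * t) * \<bar>f x * g x\<bar> + (g x)\<^sup>2 \<partial>M)"
      by (simp add: power2_diff power_mult_distrib abs_mult algebra_simps)
    also have "\<dots> = A * t\<^sup>2 - 2 * t * I + B"
      using int fg by (simp add: A_def B_def I_def)
    finally show ?thesis .
  qed
  have "I\<^sup>2 \<le> A * B"
  proof (cases "A = 0")
    case False
    then have "A > 0" using nn by simp
    then show ?thesis using quad[of "I / A"] by (simp add: power2_eq_square field_simps)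
  next
    case True
    have "I = 0"
    proof (rule ccontr)
      assume "I \<noteq> 0"
      then show False using quad[of "(B + 1) / (2 * I)"] True nn by simp
    qed
    then show ?thesis using True by simp
  qed
  then have "sqrt (I\<^sup>2) \<le> sqrt (A * B)" by (rule real_sqrt_le_mono)
  then show ?thesis using nn by (simp add: real_sqrt_mult A_def B_def I_def)
qed

definition poly_norm :: "real poly \<Rightarrow> real" where
  "poly_norm p = sqrt (\<integral>x. (poly p x)\<^sup>2 \<partial>M)"

lemma poly_norm_nonneg: "poly_norm p \<ge> 0"
  by (simp add: poly_norm_def)

lemma integrable_cpoly [simp]: "integrable M (\<lambda>x. cpoly p (of_real x))"
  by (simp add: cpoly_of_real)

lemma integrable_complex_poly [simp]: "integrable M (\<lambda>x. poly c (complex_of_real x))"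
proof -
  obtain u v where "\<And>z. poly c z = cpoly u z + \<i> * cpoly v z"
    using complex_poly_parts[of c] by blast
  then show ?thesis by simp
qed

lemma integral_abs_poly_le: "(\<integral>x. \<bar>poly p x\<bar> \<partial>M) \<le> sqrt (measure M UNIV) * poly_norm p"
  using Cauchy_Schwarz_integral[of "\<lambda>_. 1" "poly p"] by (simp add: poly_norm_def)

text \<open>The distance bound is required only almost everywhere, so that z may also be a real
  point away from the support.\<close>

lemma integrable_over_linear:
  fixes f :: "real \<Rightarrow> complex"
  assumes f: "integrable M f" and d: "d > 0" "AE x in M. norm (complex_of_real x - z) \<ge> d"
  shows "integrable M (\<lambda>x. f x / (complex_of_real x - z))"
    and "norm (\<integral>x. f x / (complex_of_real x - z) \<partial>M) \<le> (\<integral>x. norm (f x) \<partial>M) / d"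
proof -
  have [measurable]: "f \<in> borel_measurable M" using f by auto
  have AE: "AE x in M. norm (f x / (complex_of_real x - z)) \<le> norm (f x) / d"
    using d(2) by eventually_elim (use d(1) in \<open>auto simp: norm_divide intro!: divide_left_mono mult_pos_pos\<close>)
  show int: "integrable M (\<lambda>x. f x / (complex_of_real x - z))"
  proof (rule Bochner_Integration.integrable_bound[of _ "\<lambda>x. norm (f x) / d"])
    show "AE x in M. norm (f x / (complex_of_real x - z)) \<le> norm (norm (f x) / d)"
      using AE by eventually_elim (use d(1) in simp)
  qed (use f in auto)
  have "norm (\<integral>x. f x / (complex_of_real x - z) \<partial>M) \<le> (\<integral>x. norm (f x / (complex_of_real x - z)) \<partial>M)"
    by (rule integral_norm_bound)
  also have "\<dots> \<le> (\<integral>x. norm (f x) / d \<partial>M)"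
    using int f AE by (intro integral_mono_AE) auto
  finally show "norm (\<integral>x. f x / (complex_of_real x - z) \<partial>M) \<le> (\<integral>x. norm (f x) \<partial>M) / d" by simp
qed

text \<open>If two measures share all moments, \<open>(p(x) - p(z)) / (x - z)\<close> integrates to zero against
  their difference, so a nonvanishing difference of Stieltjes transforms at \<open>z\<close> bounds \<open>p(z)\<close>.\<close>
lemma eval_bounded_if_stieltjes_differs:
  assumes N: "moment_measure N" and mom: "\<And>k. (\<integral>x. x ^ k \<partial>N) = (\<integral>x. x ^ k \<partial>M)"
    and z: "Im z > 0" "(\<integral>x. 1 / (complex_of_real x - z) \<partial>M) \<noteq> (\<integral>x. 1 / (complex_of_real x - z) \<partial>N)"
  obtains C where "C \<ge> 0" "\<And>p. norm (cpoly p z) \<le> C * poly_norm p"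
proof -
  interpret N: moment_measure N by fact
  have polyeq: "(\<integral>x. poly p x \<partial>N) = (\<integral>x. poly p x \<partial>M)" for p
    by (simp only: integral_eq_sum_moments N.integral_eq_sum_moments mom)
  have cpolyeq: "(\<integral>x. poly c (complex_of_real x) \<partial>N) = (\<integral>x. poly c (complex_of_real x) \<partial>M)" for c
  proof -
    obtain u v where "\<And>z. poly c z = cpoly u z + \<i> * cpoly v z" using complex_poly_parts[of c] by blast
    then show ?thesis by (simp add: cpoly_of_real polyeq)
  qed
  have normeq: "N.poly_norm p = poly_norm p" for p
    using polyeq[of "p * p"] by (simp add: poly_norm_def N.poly_norm_def power2_eq_square)
  have masseq: "measure N UNIV = measure M UNIV" using mom[of 0] by simp
  define y where "y = Im z"
  have y: "y > 0" "norm (complex_of_real x - z) \<ge> y" for x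
    using z(1) norm_of_real_minus_ge_Im[of z x] by (auto simp: y_def)
  define S where "S = (\<integral>x. 1 / (complex_of_real x - z) \<partial>M) - (\<integral>x. 1 / (complex_of_real x - z) \<partial>N)"
  have S: "S \<noteq> 0" using z(2) by (simp add: S_def)
  have decomp: "(\<integral>x. cpoly p (of_real x) / (complex_of_real x - z) \<partial>Q) =
      cpoly p z * (\<integral>x. 1 / (complex_of_real x - z) \<partial>Q) + (\<integral>x. poly r (complex_of_real x) \<partial>Q)"
    if "moment_measure Q" and r: "\<And>w. cpoly p w = cpoly p z + (w - z) * poly r w" for p r Q
  proof -
    interpret Q: moment_measure Q by fact
    have i: "integrable Q (\<lambda>x. 1 / (complex_of_real x - z))"
      using Q.integrable_over_linear(1)[of "\<lambda>_. 1" y z] y by simp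
    have eq: "cpoly p (of_real x) / (complex_of_real x - z) =
        cpoly p z * (1 / (complex_of_real x - z)) + poly r (complex_of_real x)" for x
    proof -
      have "complex_of_real x - z \<noteq> 0" using y(1) y(2)[of x] by auto
      then show ?thesis unfolding r[of "of_real x"] by (simp add: add_divide_distrib)
    qed
    show ?thesis
      unfolding eq using i Q.integrable_complex_poly[of r]
      by (simp only: Bochner_Integration.integral_add integrable_mult_right integral_mult_right_zero)
  qed
  \<comment> \<open>Cauchy-Schwarz bounds the integral of p(x) / (x - z) against each of the two
    measures. The norm of p is the same for both, as it is computed from moments; this explains the
    factor 2.\<close>
  have "norm (cpoly p z) \<le> 2 * sqrt (measure M UNIV) / (y * norm S) * poly_norm p" for p
  proof -
    obtain r where r: "\<And>w. cpoly p w = cpoly p z + (w - z) * poly r w"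
      using poly_difference_quotient[of "map_poly complex_of_real p" z] by blast
    have bound: "norm (\<integral>x. cpoly p (of_real x) / (complex_of_real x - z) \<partial>Q) \<le> sqrt (measure M UNIV) * poly_norm p / y"
      if "Q = M \<or> Q = N" for Q
    proof -
      have "norm (\<integral>x. cpoly p (of_real x) / (complex_of_real x - z) \<partial>M) \<le> (\<integral>x. norm (cpoly p (of_real x)) \<partial>M) / y"
        using y by (intro integrable_over_linear) auto
      also have "\<dots> \<le> sqrt (measure M UNIV) * poly_norm p / y"
        using integral_abs_poly_le[of p] y by (intro divide_right_mono) (auto simp: cpoly_of_real)
      finally have 1: "norm (\<integral>x. cpoly p (of_real x) / (complex_of_real x - z) \<partial>M) \<le> sqrt (measure M UNIV) * poly_norm p / y" .
      have "norm (\<integral>x. cpoly p (of_real x) / (complex_of_real x - z) \<partial>N) \<le> (\<integral>x. norm (cpoly p (of_real x)) \<partial>N) / y"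
        using y by (intro N.integrable_over_linear) auto
      also have "\<dots> \<le> sqrt (measure M UNIV) * poly_norm p / y"
        using N.integral_abs_poly_le[of p] y by (intro divide_right_mono) (auto simp: cpoly_of_real normeq masseq)
      finally show ?thesis using 1 that by blast
    qed
    have "cpoly p z * S = (\<integral>x. cpoly p (of_real x) / (complex_of_real x - z) \<partial>M) -
        (\<integral>x. cpoly p (of_real x) / (complex_of_real x - z) \<partial>N)"
      unfolding decomp[OF moment_measure_axioms r] decomp[OF N r] S_def
      by (simp add: cpolyeq algebra_simps)
    then have "norm (cpoly p z) * norm S =
        norm ((\<integral>x. cpoly p (of_real x) / (complex_of_real x - z) \<partial>M) -
          (\<integral>x. cpoly p (of_real x) / (complex_of_real x - z) \<partial>N))"
      by (simp only: norm_mult[symmetric])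
    also have "\<dots> \<le> sqrt (measure M UNIV) * poly_norm p / y + sqrt (measure M UNIV) * poly_norm p / y"
      using bound by (intro order_trans[OF norm_triangle_ineq4 add_mono]) blast+
    finally have "norm (cpoly p z) * norm S \<le> 2 * (sqrt (measure M UNIV) * poly_norm p / y)"
      by (simp only: mult_2)
    then show ?thesis using S y(1) by (simp add: field_simps)
  qed
  moreover have "2 * sqrt (measure M UNIV) / (y * norm S) \<ge> 0" using y by simp
  ultimately show ?thesis by (rule that[rotated])
qed

end

section \<open>Holomorphy of Cauchy transforms off the support\<close>

context moment_measure
begin

lemma AE_norm_of_real_minus_ge:
  assumes K: "AE x in M. x \<in> K" and z: "ball z d \<inter> {z. Im z = 0 \<and> Re z \<in> K} = {}"
    and u: "dist z u \<le> e"
  shows "AE x in M. norm (complex_of_real x - u) \<ge> d - e"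
  using K
proof eventually_elim
  case (elim x)
  then have "complex_of_real x \<notin> ball z d" using z by auto
  then have "d \<le> dist z (complex_of_real x)" by simp
  also have "\<dots> \<le> dist z u + dist u (complex_of_real x)" by (rule dist_triangle)
  finally show ?case using u by (simp add: dist_norm norm_minus_commute)
qed

lemma open_complement_real_set:
  assumes "closed (K :: real set)"
  shows "open (- {z. Im z = 0 \<and> Re z \<in> K})"
proof -
  have "{z. Im z = 0 \<and> Re z \<in> K} = {z. Im z = 0} \<inter> Re -` K" by auto
  moreover have "closed ({z. Im z = 0} \<inter> Re -` K)"
    using assms by (intro closed_Int closed_halfspace_Im_eq closed_vimage continuous_intros)
  ultimately show ?thesis by (simp add: open_closed)
qed

text \<open>The derivative is the integral of f(x) / (x - z)^2. Subtracting it from the difference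
  quotient at u leaves (u - z) times an integral with one more factor 1 / (x - u), which is bounded
  uniformly for u near z.\<close>

lemma holomorphic_cauchy_transform:
  fixes f :: "real \<Rightarrow> complex"
  assumes f: "integrable M f" and K: "closed K" "AE x in M. x \<in> K"
  shows "(\<lambda>z. \<integral>x. f x / (complex_of_real x - z) \<partial>M) holomorphic_on - {z. Im z = 0 \<and> Re z \<in> K}"
    (is "?F holomorphic_on - ?K")
proof -
  have "?F field_differentiable at z" if z: "z \<in> - ?K" for z
  proof -
    obtain d where d: "d > 0" "ball z d \<subseteq> - ?K"
      using open_complement_real_set[OF K(1)] z by (meson openE)
    \<comment> \<open>Half the distance: every u within e of z still keeps distance e from the
      support.\<close>
    define e where "e = d / 2"
    have e: "e > 0" using d by (simp add: e_def)
    have AE: "AE x in M. norm (complex_of_real x - u) \<ge> e" if "dist z u \<le> e" for u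
      using AE_norm_of_real_minus_ge[OF K(2), of z d u e] d(2) that by (auto simp: e_def)
    define F2 where "F2 = (\<integral>x. f x / (complex_of_real x - z) / (complex_of_real x - z) \<partial>M)"
    have i1: "integrable M (\<lambda>x. f x / (complex_of_real x - u))" if "dist z u \<le> e" for u
      by (rule integrable_over_linear(1)[OF f e AE[OF that]])
    have i2: "integrable M (\<lambda>x. f x / (complex_of_real x - z) / (complex_of_real x - z))"
      by (rule integrable_over_linear(1)[OF i1 e AE]) (use e in auto)
    define B where "B = (\<integral>x. norm (f x / (complex_of_real x - z) / (complex_of_real x - z)) \<partial>M)"
    have diff: "norm ((?F u - ?F z) / (u - z) - F2) \<le> norm (u - z) * (B / e)"
      if u: "dist z u \<le> e" "u \<noteq> z" for u
    proof -
      have i3: "integrable M (\<lambda>x. f x / (complex_of_real x - z) / (complex_of_real x - z) / (complex_of_real x - u))"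
        by (rule integrable_over_linear(1)[OF i2 e AE[OF u(1)]])
      have AEz: "AE x in M. norm (complex_of_real x - z) \<ge> e" by (rule AE) (use e in auto)
      have iz: "integrable M (\<lambda>x. f x / (complex_of_real x - z))" by (rule i1) (use e in auto)
      have F2_eq: "(u - z) * F2 = (\<integral>x. (u - z) * (f x / (complex_of_real x - z) / (complex_of_real x - z)) \<partial>M)"
        unfolding F2_def by (rule integral_mult_right_zero[symmetric])
      have "?F u - ?F z - (u - z) * F2 =
          (\<integral>x. f x / (complex_of_real x - u) - f x / (complex_of_real x - z)
             - (u - z) * (f x / (complex_of_real x - z) / (complex_of_real x - z)) \<partial>M)"
        unfolding F2_eq using i1[OF u(1)] iz integrable_mult_right[OF i2]
        by (simp only: Bochner_Integration.integral_diff Bochner_Integration.integrable_diff)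
      also have "\<dots> = (\<integral>x. (u - z) * (u - z) *
          (f x / (complex_of_real x - z) / (complex_of_real x - z) / (complex_of_real x - u)) \<partial>M)"
      proof (rule integral_cong_AE)
        show "AE x in M. f x / (complex_of_real x - u) - f x / (complex_of_real x - z)
             - (u - z) * (f x / (complex_of_real x - z) / (complex_of_real x - z)) =
             (u - z) * (u - z) * (f x / (complex_of_real x - z) / (complex_of_real x - z) / (complex_of_real x - u))"
          using AE[OF u(1)] AEz
        proof eventually_elim
          case (elim x)
          then have "complex_of_real x - u \<noteq> 0" "complex_of_real x - z \<noteq> 0" using e by auto
          moreover have alg: "a / p - a / q - (q - p) * (a / q / q) = (q - p) * (q - p) * (a / q / q / p)"
            if "p \<noteq> 0" "q \<noteq> 0" for a p q :: complex
            using that by (simp add: field_simps)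
          ultimately show ?case
            using alg[of "complex_of_real x - u" "complex_of_real x - z" "f x"] by simp
        qed
      qed (use f in auto)
      also have "\<dots> = (u - z) * (u - z) *
          (\<integral>x. f x / (complex_of_real x - z) / (complex_of_real x - z) / (complex_of_real x - u) \<partial>M)"
        by (rule integral_mult_right_zero)
      finally have "(?F u - ?F z) / (u - z) - F2 = (u - z) *
          (\<integral>x. f x / (complex_of_real x - z) / (complex_of_real x - z) / (complex_of_real x - u) \<partial>M)"
        using u(2) by (simp add: field_simps)
      then have "norm ((?F u - ?F z) / (u - z) - F2) = norm (u - z) *
          norm (\<integral>x. f x / (complex_of_real x - z) / (complex_of_real x - z) / (complex_of_real x - u) \<partial>M)"
        by (simp only: norm_mult)
      also have "\<dots> \<le> norm (u - z) * (B / e)"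
        unfolding B_def by (intro mult_left_mono integrable_over_linear(2)[OF i2 e AE[OF u(1)]]) auto
      finally show ?thesis .
    qed
    have "((\<lambda>u. (?F u - ?F z) / (u - z) - F2) \<longlongrightarrow> 0) (at z)"
    proof (rule Lim_null_comparison)
      show "\<forall>\<^sub>F u in at z. norm ((?F u - ?F z) / (u - z) - F2) \<le> norm (u - z) * (B / e)"
        unfolding eventually_at using e diff by (intro exI[of _ e]) (auto simp: dist_commute)
      have "((\<lambda>u. norm (u - z) * (B / e)) \<longlongrightarrow> norm (z - z) * (B / e)) (at z)"
        by (intro tendsto_intros)
      then show "((\<lambda>u. norm (u - z) * (B / e)) \<longlongrightarrow> 0) (at z)" by simp
    qed
    then have "((\<lambda>u. (?F u - ?F z) / (u - z)) \<longlongrightarrow> F2) (at z)" by (rule LIM_zero_cancel)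
    then have "(?F has_field_derivative F2) (at z)" by (simp add: has_field_derivative_iff)
    then show ?thesis by (auto simp: field_differentiable_def)
  qed
  then show ?thesis
    by (auto simp: holomorphic_on_def intro: field_differentiable_at_within)
qed

end

section \<open>Orthonormal expansions and the reproducing kernel\<close>

locale orthonormal_measure = moment_measure M for M :: "real measure" +
  fixes P :: "nat \<Rightarrow> real poly"
  assumes orthonormal: "orthonormal_polys M P"
begin

lemma degree_P: "degree (P n) = n"
  using orthonormal unfolding orthonormal_polys_def by blast

lemma P_nonzero: "P n \<noteq> 0"
proof -
  have "lead_coeff (P n) > 0" using orthonormal unfolding orthonormal_polys_def by blast
  then show ?thesis by auto
qed

lemma integral_P_mult: "(\<integral>x. poly (P n) x * poly (P m) x \<partial>M) = (if n = m then 1 else 0)"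
  using orthonormal unfolding orthonormal_polys_def by blast

lemma expansion: "degree p < n \<Longrightarrow> \<exists>c. p = (\<Sum>k<n. smult (c k) (P k))"
  by (rule poly_in_span_graded) (auto simp: degree_P P_nonzero)

lemma integral_sum_mult_P:
  assumes "finite I"
  shows "(\<integral>x. poly (\<Sum>k\<in>I. smult (c k) (P k)) x * poly (P m) x \<partial>M) = (if m \<in> I then c m else 0)"
proof -
  have "(\<integral>x. poly (\<Sum>k\<in>I. smult (c k) (P k)) x * poly (P m) x \<partial>M) =
      (\<integral>x. (\<Sum>k\<in>I. c k * (poly (P k) x * poly (P m) x)) \<partial>M)"
    by (simp add: poly_sum sum_distrib_right mult.assoc)
  also have "\<dots> = (\<Sum>k\<in>I. c k * (\<integral>x. poly (P k) x * poly (P m) x \<partial>M))" by simp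
  also have "\<dots> = (\<Sum>k\<in>I. if k = m then c k else 0)"
    by (intro sum.cong) (auto simp: integral_P_mult)
  finally show ?thesis using assms by simp
qed

lemma integral_sum_square:
  assumes "finite I"
  shows "(\<integral>x. (poly (\<Sum>k\<in>I. smult (c k) (P k)) x)\<^sup>2 \<partial>M) = (\<Sum>k\<in>I. (c k)\<^sup>2)"
proof -
  define s where "s = (\<Sum>k\<in>I. smult (c k) (P k))"
  have "(\<integral>x. (poly s x)\<^sup>2 \<partial>M) = (\<integral>x. (\<Sum>k\<in>I. c k * (poly s x * poly (P k) x)) \<partial>M)"
    by (subst (2) s_def) (simp add: power2_eq_square poly_sum sum_distrib_left mult_ac s_def)
  also have "\<dots> = (\<Sum>k\<in>I. c k * (\<integral>x. poly s x * poly (P k) x \<partial>M))" by simp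
  also have "\<dots> = (\<Sum>k\<in>I. (c k)\<^sup>2)"
    unfolding s_def integral_sum_mult_P[OF assms] by (simp add: power2_eq_square)
  finally show ?thesis by (simp add: s_def)
qed

lemma poly_norm_sum: "finite I \<Longrightarrow> poly_norm (\<Sum>k\<in>I. smult (c k) (P k)) = sqrt (\<Sum>k\<in>I. (c k)\<^sup>2)"
  by (simp add: poly_norm_def integral_sum_square)

text \<open>Strictness is drawn from the orthonormal system itself: by Parseval the integral is a
  sum of squared coefficients, and these do not all vanish.\<close>

lemma integral_square_pos:
  assumes "p \<noteq> 0"
  shows "(\<integral>x. (poly p x)\<^sup>2 \<partial>M) > 0"
proof -
  obtain c where c: "p = (\<Sum>k<Suc (degree p). smult (c k) (P k))" using expansion[of p "Suc (degree p)"] by auto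
  have "(\<Sum>k<Suc (degree p). (c k)\<^sup>2) \<noteq> 0"
  proof
    assume "(\<Sum>k<Suc (degree p). (c k)\<^sup>2) = 0"
    then have "\<forall>k<Suc (degree p). c k = 0" by (subst (asm) sum_nonneg_eq_0_iff) auto
    then show False using c assms by (metis (no_types, lifting) lessThan_iff smult_0_left sum.neutral)
  qed
  moreover have "(\<Sum>k<Suc (degree p). (c k)\<^sup>2) \<ge> 0" by (intro sum_nonneg) auto
  moreover have "(\<integral>x. (poly p x)\<^sup>2 \<partial>M) = (\<Sum>k<Suc (degree p). (c k)\<^sup>2)"
    by (subst c, subst integral_sum_square) auto
  ultimately show ?thesis by linarith
qed

text \<open>The first n orthonormal polynomials span the polynomials of degree below n, so both
  sides speak of the same approximants.\<close>

lemma orthonormal_basis_iff: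
  "orthonormal_basis_L2 M (\<lambda>n x. poly (P n) x) \<longleftrightarrow> (\<forall>f\<in>L2 M. poly_approximable f)"
proof -
  have "(\<exists>N c. (\<integral>x. (f x - (\<Sum>k<N. c k * poly (P k) x))\<^sup>2 \<partial>M) < \<epsilon>) \<longleftrightarrow>
      (\<exists>p. (\<integral>x. (f x - poly p x)\<^sup>2 \<partial>M) < \<epsilon>)" (is "?L \<longleftrightarrow> ?R") for f \<epsilon>
  proof
    assume ?L
    then obtain N c where "(\<integral>x. (f x - (\<Sum>k<N. c k * poly (P k) x))\<^sup>2 \<partial>M) < \<epsilon>" by blast
    then show ?R by (intro exI[of _ "\<Sum>k<N. smult (c k) (P k)"]) (simp add: poly_sum)
  next
    assume ?R
    then obtain p where p: "(\<integral>x. (f x - poly p x)\<^sup>2 \<partial>M) < \<epsilon>" by blast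
    define n where "n = Suc (degree p)"
    obtain c where c: "p = (\<Sum>k<n. smult (c k) (P k))" using expansion[of p n] by (auto simp: n_def)
    have "(\<lambda>x. \<Sum>k<n. c k * poly (P k) x) = poly p" by (auto simp: c poly_sum)
    then have "(\<integral>x. (f x - (\<Sum>k<n. c k * poly (P k) x))\<^sup>2 \<partial>M) < \<epsilon>"
      using p by (simp add: fun_eq_iff)
    then show ?L by blast
  qed
  then show ?thesis
    unfolding orthonormal_basis_L2_def poly_approximable_def by (auto simp: integral_P_mult)
qed

text \<open>The Christoffel-Darboux kernel over an arbitrary index set, so that tails of the series
  are kernels too. There is no conjugation, so integrating a polynomial against it returns the value
  at w itself.\<close>

definition kernel :: "nat set \<Rightarrow> complex \<Rightarrow> real \<Rightarrow> complex" where
  "kernel I w x = (\<Sum>k\<in>I. cpoly (P k) w * of_real (poly (P k) x))"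

text \<open>The squared L2 norm of the kernel; over an initial segment of indices, the reciprocal of
  the Christoffel function at w.\<close>

definition eval_norm2 :: "nat set \<Rightarrow> complex \<Rightarrow> real" where
  "eval_norm2 I w = (\<Sum>k\<in>I. (norm (cpoly (P k) w))\<^sup>2)"

lemma integrable_mult_kernel [simp]: "integrable M (\<lambda>x. poly c (complex_of_real x) * kernel I w x)"
proof -
  have "poly c (complex_of_real x) * kernel I w x =
      (\<Sum>k\<in>I. cpoly (P k) w * poly (c * map_poly of_real (P k)) (complex_of_real x))" for x
    by (simp add: kernel_def sum_distrib_left cpoly_of_real mult_ac)
  then show ?thesis by (simp del: poly_mult)
qed

lemma integrable_kernel [simp]: "integrable M (kernel I w)"
  using integrable_mult_kernel[of 1 I w] by simp

lemma norm_kernel_square: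
  "(norm (kernel I w x))\<^sup>2 = (poly (\<Sum>k\<in>I. smult (Re (cpoly (P k) w)) (P k)) x)\<^sup>2 +
     (poly (\<Sum>k\<in>I. smult (Im (cpoly (P k) w)) (P k)) x)\<^sup>2"
  unfolding cmod_power2 by (simp add: kernel_def poly_sum)

lemma kernel_square:
  assumes "finite I"
  shows "integrable M (\<lambda>x. (norm (kernel I w x))\<^sup>2)"
    and "(\<integral>x. (norm (kernel I w x))\<^sup>2 \<partial>M) = eval_norm2 I w"
  unfolding norm_kernel_square
   apply simp
  using assms by (simp add: integral_sum_square eval_norm2_def cmod_power2 sum.distrib)

lemma integral_poly_kernel_le:
  assumes "finite I"
  shows "(\<integral>x. norm (of_real (poly p x) * kernel I w x) \<partial>M) \<le> poly_norm p * sqrt (eval_norm2 I w)"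
proof -
  have "kernel I w \<in> borel_measurable M" using integrable_kernel by (rule borel_measurable_integrable)
  then have "(\<integral>x. \<bar>poly p x * norm (kernel I w x)\<bar> \<partial>M) \<le>
      sqrt (\<integral>x. (poly p x)\<^sup>2 \<partial>M) * sqrt (\<integral>x. (norm (kernel I w x))\<^sup>2 \<partial>M)"
    using kernel_square(1)[OF assms] by (intro Cauchy_Schwarz_integral) auto
  then show ?thesis
    by (simp add: kernel_square(2)[OF assms] poly_norm_def norm_mult abs_mult)
qed

lemma kernel_reproducing_real:
  assumes "degree u < n"
  shows "(\<integral>x. of_real (poly u x) * kernel {..<n} w x \<partial>M) = cpoly u w"
proof -
  obtain c where c: "u = (\<Sum>k<n. smult (c k) (P k))" using expansion[OF assms] by blast
  have "(\<integral>x. of_real (poly u x) * kernel {..<n} w x \<partial>M) =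
      (\<integral>x. (\<Sum>k<n. cpoly (P k) w * of_real (poly u x * poly (P k) x)) \<partial>M)"
    by (simp add: kernel_def sum_distrib_left mult_ac)
  also have "\<dots> = (\<Sum>k<n. cpoly (P k) w * of_real (\<integral>x. poly u x * poly (P k) x \<partial>M))"
  proof -
    have "complex_integrable M (\<lambda>x. of_real (poly u x * poly (P k) x))" for k
      by (intro integrable_of_real integrable_poly_mult)
    then show ?thesis by (simp only: Bochner_Integration.integral_sum integrable_mult_right integral_mult_right_zero integral_complex_of_real)
  qed
  also have "\<dots> = (\<Sum>k<n. cpoly (P k) w * of_real (c k))"
    unfolding c by (intro sum.cong) (simp_all only: integral_sum_mult_P finite_lessThan, simp)
  also have "\<dots> = cpoly u w"
    unfolding c cpoly_sum cpoly_smult by (simp add: mult.commute)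
  finally show ?thesis .
qed

lemma kernel_reproducing:
  assumes "degree c < n"
  shows "(\<integral>x. poly c (complex_of_real x) * kernel {..<n} w x \<partial>M) = poly c w"
proof -
  obtain u v where deg: "degree u \<le> degree c" "degree v \<le> degree c"
    and uv: "\<And>z. poly c z = cpoly u z + \<i> * cpoly v z"
    using complex_poly_parts[of c] by metis
  have i: "integrable M (\<lambda>x. cpoly u (of_real x) * kernel {..<n} w x)"
    "integrable M (\<lambda>x. cpoly v (of_real x) * kernel {..<n} w x)"
    by (rule integrable_mult_kernel)+
  have "(\<integral>x. poly c (complex_of_real x) * kernel {..<n} w x \<partial>M) =
      (\<integral>x. cpoly u (of_real x) * kernel {..<n} w x + \<i> * (cpoly v (of_real x) * kernel {..<n} w x) \<partial>M)"
    by (simp add: uv distrib_right mult.assoc)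
  also have "\<dots> = (\<integral>x. cpoly u (of_real x) * kernel {..<n} w x \<partial>M) + \<i> * (\<integral>x. cpoly v (of_real x) * kernel {..<n} w x \<partial>M)"
    using i by (simp only: Bochner_Integration.integral_add integrable_mult_right integral_mult_right_zero)
  also have "\<dots> = poly c w"
    using deg assms by (simp add: cpoly_of_real kernel_reproducing_real uv)
  finally show ?thesis .
qed

text \<open>Testing the bound on the real and imaginary parts of the kernel itself.\<close>
lemma eval_norm2_le:
  assumes C: "C \<ge> 0" "\<And>p. norm (cpoly p w) \<le> C * poly_norm p" and "finite I"
  shows "eval_norm2 I w \<le> 4 * C\<^sup>2"
proof -
  let ?d = "\<lambda>k. cpoly (P k) w"
  define u where "u = (\<Sum>k\<in>I. smult (Re (?d k)) (P k))"
  define v where "v = (\<Sum>k\<in>I. smult (Im (?d k)) (P k))"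
  define T where "T = eval_norm2 I w"
  have "T \<ge> 0" unfolding T_def eval_norm2_def by (intro sum_nonneg) auto
  have "of_real T = (\<Sum>k\<in>I. ?d k * cnj (?d k))"
    by (simp only: T_def eval_norm2_def of_real_sum complex_norm_square)
  also have "\<dots> = cpoly u w - \<i> * cpoly v w"
  proof -
    have "z * cnj z = of_real (Re z) * z - \<i> * (of_real (Im z) * z)" for z
      by (simp add: complex_eq_iff algebra_simps)
    then show ?thesis
      unfolding u_def v_def cpoly_sum cpoly_smult sum_distrib_left sum_subtractf[symmetric]
      by (intro sum.cong) simp_all
  qed
  finally have "T = norm (cpoly u w - \<i> * cpoly v w)" using \<open>T \<ge> 0\<close> by (metis norm_of_real abs_of_nonneg)
  also have "\<dots> \<le> norm (cpoly u w) + norm (cpoly v w)"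
    using norm_triangle_ineq4[of "cpoly u w" "\<i> * cpoly v w"] by (simp add: norm_mult)
  also have "\<dots> \<le> C * poly_norm u + C * poly_norm v" using C by (intro add_mono) auto
  \<comment> \<open>The coefficients of each part are dominated by those of the kernel, so each norm
    is at most \<open>sqrt T\<close>. The hypothesis on C covers real polynomials only; having two
    parts produces the 2 whose square is the 4 in the claim.\<close>
  also have "\<dots> \<le> C * sqrt T + C * sqrt T"
    unfolding u_def v_def poly_norm_sum[OF \<open>finite I\<close>] T_def eval_norm2_def cmod_power2
    using C(1) by (intro add_mono mult_left_mono real_sqrt_le_mono sum_mono) auto
  finally have "T \<le> 2 * C * sqrt T" by simp
  then have "sqrt T * sqrt T \<le> 2 * C * sqrt T" using \<open>T \<ge> 0\<close> by simp
  then have "sqrt T \<le> 2 * C"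
    using \<open>T \<ge> 0\<close> C(1) by (cases "T = 0") (auto intro: mult_right_le_imp_le[of _ "sqrt T"])
  then have "(sqrt T)\<^sup>2 \<le> (2 * C)\<^sup>2" using \<open>T \<ge> 0\<close> by (intro power_mono) auto
  then show ?thesis using \<open>T \<ge> 0\<close> by (simp add: T_def)
qed

text \<open>Off the support, \<open>\<Gamma>(z) = \<integral> kernel(w, x) / (x - z) d\<mu>(x)\<close> is holomorphic. The reproducing
  property turns \<open>\<Gamma>\<close> into the identity \<open>p(z) G(z) = p(w) + (z - w) \<integral> p(x) kernel(w, x) / (x - z) d\<mu>(x)\<close>
  with \<open>G(z) = 1 + (z - w) \<Gamma>(z)\<close>. As \<open>G(w) = 1\<close>, its zeros are isolated, hence some circle around 0
  avoids both them and the support, and the maximum principle applies inside it.\<close>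
lemma eval_bounded_near_zero:
  assumes w: "Im w \<noteq> 0" and C: "C \<ge> 0" "\<And>p. norm (cpoly p w) \<le> C * poly_norm p"
    and K: "closed K" "countable K" "AE x in M. x \<in> K"
    and ab: "0 \<le> a" "a < b" "\<And>x. x \<in> K \<Longrightarrow> \<bar>x\<bar> \<le> a \<or> \<bar>x\<bar> \<ge> b"
  obtains D where "\<And>p x. \<bar>x\<bar> \<le> a \<Longrightarrow> \<bar>poly p x\<bar> \<le> D * poly_norm p"
proof -
  define \<Omega> where "\<Omega> = - {z. Im z = 0 \<and> Re z \<in> K}"
  have open_\<Omega>: "open \<Omega>" unfolding \<Omega>_def by (rule open_complement_real_set[OF K(1)])
  \<comment> \<open>The plane minus a countable set is connected. This lets the value of
    \<open>G\<close> at w control its zeros near the circle.\<close>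
  have conn_\<Omega>: "connected \<Omega>"
  proof -
    have "{z. Im z = 0 \<and> Re z \<in> K} \<subseteq> complex_of_real ` K" by (auto simp: complex_eq_iff image_iff)
    then have "countable {z. Im z = 0 \<and> Re z \<in> K}" using K(2) by (meson countable_image countable_subset)
    then show ?thesis
      unfolding \<Omega>_def by (intro path_connected_imp_connected path_connected_complement_countable) auto
  qed
  have w\<Omega>: "w \<in> \<Omega>" using w by (simp add: \<Omega>_def)
  have AE_dist: "AE x in M. norm (complex_of_real x - u) \<ge> d - e" if "ball z d \<subseteq> \<Omega>" "dist z u \<le> e" for z u d e
    using AE_norm_of_real_minus_ge[OF K(3), of z d u e] that by (auto simp: \<Omega>_def)
  define s where "s n = eval_norm2 {..<n} w" for n
  have s_le: "s n \<le> 4 * C\<^sup>2" for n unfolding s_def by (rule eval_norm2_le[OF C]) simp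
  have "incseq s" unfolding s_def eval_norm2_def by (intro incseq_SucI) simp
  then obtain \<sigma> where \<sigma>: "s \<longlonglongrightarrow> \<sigma>" "\<And>n. s n \<le> \<sigma>"
    using incseq_convergent[of s "4 * C\<^sup>2"] s_le by blast
  define m where "m = sqrt (measure M UNIV)"
  have m0: "m \<ge> 0" by (simp add: m_def)
  define g where "g n z = (\<integral>x. kernel {..<n} w x / (complex_of_real x - z) \<partial>M)" for n z
  have g_hol: "g n holomorphic_on \<Omega>" for n
    using holomorphic_cauchy_transform[OF integrable_kernel K(1,3), of "{..<n}" w]
    by (simp add: g_def[abs_def] \<Omega>_def)
  \<comment> \<open>The difference is the Cauchy transform of a tail of the kernel, whose squared
    norm is \<open>s l - s n\<close>. The bound is independent of l and depends on z only through
    its distance d from the support, so it gives both the Cauchy property and locally uniform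
    convergence.\<close>
  have g_diff: "norm (g l z - g n z) \<le> m * sqrt (\<sigma> - s n) / d"
    if nl: "n \<le> l" and d: "d > 0" "AE x in M. norm (complex_of_real x - z) \<ge> d" for n l z d
  proof -
    have split: "{..<l} = {..<n} \<union> {n..<l}" "{..<n} \<inter> {n..<l} = {}" using nl by auto
    have k: "kernel {..<l} w x = kernel {..<n} w x + kernel {n..<l} w x" for x
      unfolding kernel_def split(1) by (intro sum.union_disjoint split(2)) auto
    have s: "s l = s n + eval_norm2 {n..<l} w"
      unfolding s_def eval_norm2_def split(1) by (intro sum.union_disjoint split(2)) auto
    have i: "integrable M (\<lambda>x. kernel I w x / (complex_of_real x - z))" for I
      by (rule integrable_over_linear(1)[OF integrable_kernel d])
    have "g l z - g n z = (\<integral>x. kernel {n..<l} w x / (complex_of_real x - z) \<partial>M)"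
      unfolding g_def k add_divide_distrib using i by simp
    also have "norm \<dots> \<le> (\<integral>x. norm (kernel {n..<l} w x) \<partial>M) / d"
      by (rule integrable_over_linear(2)[OF integrable_kernel d])
    also have "\<dots> \<le> m * sqrt (eval_norm2 {n..<l} w) / d"
      using integral_poly_kernel_le[of "{n..<l}" 1 w] d(1)
      by (intro divide_right_mono) (simp_all add: poly_norm_def m_def)
    also have "\<dots> \<le> m * sqrt (\<sigma> - s n) / d"
      using \<sigma>(2)[of l] s d(1) m0 by (intro divide_right_mono mult_left_mono real_sqrt_le_mono) auto
    finally show ?thesis .
  qed
  have c_lim: "(\<lambda>n. m * sqrt (\<sigma> - s n) / d) \<longlonglongrightarrow> 0" for d :: real
  proof -
    have "(\<lambda>n. m * sqrt (\<sigma> - s n) / d) \<longlonglongrightarrow> m * sqrt (\<sigma> - \<sigma>) * inverse d"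
      unfolding divide_inverse by (intro tendsto_intros \<sigma>(1))
    then show ?thesis by simp
  qed
  have g_conv: "convergent (\<lambda>n. g n z)" if z: "z \<in> \<Omega>" for z
  proof -
    obtain d where d: "d > 0" "ball z d \<subseteq> \<Omega>" using open_\<Omega> z by (meson openE)
    have AE: "AE x in M. norm (complex_of_real x - z) \<ge> d" using AE_dist[OF d(2), of z 0] by simp
    have "Cauchy (\<lambda>n. g n z)"
    proof (rule CauchyI')
      fix e :: real assume "e > 0"
      then have "\<forall>\<^sub>F n in sequentially. m * sqrt (\<sigma> - s n) / d < e"
        using order_tendstoD(2)[OF c_lim] by blast
      then obtain n0 where n0: "\<And>n. n \<ge> n0 \<Longrightarrow> m * sqrt (\<sigma> - s n) / d < e"
        by (auto simp: eventually_sequentially)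
      have "dist (g n z) (g l z) < e" if "n \<ge> n0" "l > n" for n l
        using g_diff[of n l d z] d(1) AE n0[of n] that by (simp add: dist_norm norm_minus_commute)
      then show "\<exists>N. \<forall>n\<ge>N. \<forall>l>n. dist (g n z) (g l z) < e" by blast
    qed
    then show ?thesis by (rule Cauchy_convergent)
  qed
  define \<Gamma> where "\<Gamma> z = lim (\<lambda>n. g n z)" for z
  have \<Gamma>: "(\<lambda>n. g n z) \<longlonglongrightarrow> \<Gamma> z" if "z \<in> \<Omega>" for z
    using g_conv[OF that] by (simp add: \<Gamma>_def convergent_LIMSEQ_iff)
  have \<Gamma>_hol: "\<Gamma> holomorphic_on \<Omega>"
  proof (rule holomorphic_uniform_sequence[OF open_\<Omega> g_hol])
    fix z assume "z \<in> \<Omega>"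
    then obtain d where d: "d > 0" "ball z d \<subseteq> \<Omega>" using open_\<Omega> by (meson openE)
    define e where "e = d / 2"
    have e: "e > 0" "cball z e \<subseteq> \<Omega>" using d by (auto simp: e_def)
    have "uniform_limit (cball z e) g \<Gamma> sequentially"
    proof (rule uniform_limitI)
      fix r :: real assume "r > 0"
      then have "\<forall>\<^sub>F n in sequentially. m * sqrt (\<sigma> - s n) / e < r"
        using order_tendstoD(2)[OF c_lim] by blast
      then show "\<forall>\<^sub>F n in sequentially. \<forall>u\<in>cball z e. dist (g n u) (\<Gamma> u) < r"
      proof eventually_elim
        case (elim n)
        show ?case
        proof
          fix u assume u: "u \<in> cball z e"
          have AE: "AE x in M. norm (complex_of_real x - u) \<ge> e"
            using AE_dist[OF d(2), of u e] u by (simp add: e_def)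
          have "(\<lambda>l. norm (g l u - g n u)) \<longlonglongrightarrow> norm (\<Gamma> u - g n u)"
            using u e by (intro tendsto_intros \<Gamma>) auto
          moreover have "\<forall>\<^sub>F l in sequentially. norm (g l u - g n u) \<le> m * sqrt (\<sigma> - s n) / e"
            using eventually_ge_at_top[of n] by eventually_elim (rule g_diff[OF _ e(1) AE])
          ultimately have "norm (\<Gamma> u - g n u) \<le> m * sqrt (\<sigma> - s n) / e"
            by (rule tendsto_upperbound) simp
          then show "dist (g n u) (\<Gamma> u) < r" using elim by (simp add: dist_norm norm_minus_commute)
        qed
      qed
    qed
    then show "\<exists>d>0. cball z d \<subseteq> \<Omega> \<and> uniform_limit (cball z d) g \<Gamma> sequentially" using e by blast
  qed
  define G where "G z = 1 + (z - w) * \<Gamma> z" for z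
  have G_hol: "G holomorphic_on \<Omega>" unfolding G_def[abs_def] by (intro holomorphic_intros \<Gamma>_hol)
  have Gw: "G w = 1" by (simp add: G_def)
  \<comment> \<open>For n > degree p the kernel of order n reproduces the difference quotient
    \<open>r\<close> at w, so the identity is exact with \<open>g n\<close> in place of
    \<open>\<Gamma>\<close>; the estimate then passes to the limit. The number \<open>2 * C\<close>
    bounds the norm of the kernel.\<close>
  have bound: "norm (cpoly p z) * norm (G z) \<le> (C + norm (z - w) * (2 * C / d)) * poly_norm p"
    if d: "d > 0" "AE x in M. norm (complex_of_real x - z) \<ge> d" and z: "z \<in> \<Omega>" for p z d
  proof -
    obtain r where r: "\<And>u. cpoly p u = cpoly p z + (u - z) * poly r u" and dr: "degree r \<le> degree p"
      using poly_difference_quotient[of "map_poly complex_of_real p" z]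
      by (metis degree_map_poly of_real_eq_0_iff)
    have "norm (cpoly p z * (1 + (z - w) * g n z)) \<le> (C + norm (z - w) * (2 * C / d)) * poly_norm p"
      if n: "n > degree p" for n
    proof -
      define J where "J = (\<integral>x. of_real (poly p x) * kernel {..<n} w x / (complex_of_real x - z) \<partial>M)"
      have ik: "integrable M (\<lambda>x. kernel {..<n} w x / (complex_of_real x - z))"
        by (rule integrable_over_linear(1)[OF integrable_kernel d])
      have ipk: "integrable M (\<lambda>x. of_real (poly p x) * kernel {..<n} w x)"
        using integrable_mult_kernel[of "map_poly of_real p" "{..<n}" w] by (simp add: cpoly_of_real)
      have ir: "integrable M (\<lambda>x. poly r (complex_of_real x) * kernel {..<n} w x)"
        by (rule integrable_mult_kernel)
      have "J = (\<integral>x. cpoly p z * (kernel {..<n} w x / (complex_of_real x - z)) +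
          poly r (complex_of_real x) * kernel {..<n} w x \<partial>M)"
        unfolding J_def
      proof (rule integral_cong_AE)
        show "AE x in M. of_real (poly p x) * kernel {..<n} w x / (complex_of_real x - z) =
            cpoly p z * (kernel {..<n} w x / (complex_of_real x - z)) + poly r (complex_of_real x) * kernel {..<n} w x"
          using d(2)
        proof eventually_elim
          case (elim x)
          then have "complex_of_real x - z \<noteq> 0" using d(1) by auto
          then show ?case
            unfolding cpoly_of_real[symmetric] r[of "of_real x"]
            by (simp add: distrib_right add_divide_distrib)
        qed
        show "(\<lambda>x. of_real (poly p x) * kernel {..<n} w x / (complex_of_real x - z)) \<in> borel_measurable M"
          using integrable_over_linear(1)[OF ipk d] by (rule borel_measurable_integrable)
        show "(\<lambda>x. cpoly p z * (kernel {..<n} w x / (complex_of_real x - z)) +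
            poly r (complex_of_real x) * kernel {..<n} w x) \<in> borel_measurable M"
          using ik ir by (intro borel_measurable_integrable Bochner_Integration.integrable_add integrable_mult_right)
      qed
      also have "\<dots> = cpoly p z * g n z + poly r w"
      proof -
        have "(\<integral>x. poly r (complex_of_real x) * kernel {..<n} w x \<partial>M) = poly r w"
          using dr n by (intro kernel_reproducing) simp
        then show ?thesis
          unfolding g_def using ik ir
          by (simp only: Bochner_Integration.integral_add integrable_mult_right integral_mult_right_zero)
      qed
      finally have J: "J = cpoly p z * g n z + poly r w" .
      have "cpoly p z * (1 + (z - w) * g n z) = cpoly p w + (z - w) * J"
        unfolding J r[of w] by (simp add: algebra_simps)
      also have "norm \<dots> \<le> norm (cpoly p w) + norm (z - w) * norm J"
        by (metis norm_mult norm_triangle_ineq)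
      also have "\<dots> \<le> C * poly_norm p + norm (z - w) * (poly_norm p * (2 * C) / d)"
      proof (intro add_mono mult_left_mono C(2))
        have "norm J \<le> (\<integral>x. norm (of_real (poly p x) * kernel {..<n} w x) \<partial>M) / d"
          unfolding J_def by (rule integrable_over_linear(2)[OF ipk d])
        also have "\<dots> \<le> poly_norm p * sqrt (s n) / d"
          unfolding s_def using d(1) by (intro divide_right_mono integral_poly_kernel_le) auto
        also have "\<dots> \<le> poly_norm p * (2 * C) / d"
        proof -
          have "sqrt (s n) \<le> 2 * C"
            using s_le[of n] C(1) by (intro real_le_lsqrt) (simp_all add: power_mult_distrib)
          then show ?thesis using C(1) d(1) poly_norm_nonneg by (intro divide_right_mono mult_left_mono) auto
        qed
        finally show "norm J \<le> poly_norm p * (2 * C) / d" .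
      qed simp
      also have "\<dots> = (C + norm (z - w) * (2 * C / d)) * poly_norm p" by (simp add: algebra_simps)
      finally show ?thesis .
    qed
    then have ev: "\<forall>\<^sub>F n in sequentially. norm (cpoly p z * (1 + (z - w) * g n z)) \<le> (C + norm (z - w) * (2 * C / d)) * poly_norm p"
      using eventually_gt_at_top[of "degree p"] by (rule eventually_mono[rotated])
    have "(\<lambda>n. norm (cpoly p z * (1 + (z - w) * g n z))) \<longlonglongrightarrow> norm (cpoly p z * G z)"
      unfolding G_def by (intro tendsto_intros \<Gamma> z)
    then show ?thesis
      unfolding norm_mult[symmetric] using ev by (rule tendsto_upperbound) simp
  qed
  \<comment> \<open>Trisecting the gap puts a closed annulus strictly inside it; compactness then
    allows only finitely many zeros of \<open>G\<close> there.\<close>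
  define a' where "a' = (2 * a + b) / 3"
  define b' where "b' = (a + 2 * b) / 3"
  have ab': "a < a'" "a' < b'" "b' < b" using ab(2) by (auto simp: a'_def b'_def)
  define A where "A = cball (0 :: complex) b' - ball 0 a'"
  have "compact A" unfolding A_def by (intro compact_diff compact_cball open_ball)
  moreover have "A \<subseteq> \<Omega>"
  proof
    fix z assume "z \<in> A"
    then have n: "a' \<le> norm z" "norm z \<le> b'" by (auto simp: A_def)
    have False if "Im z = 0" "Re z \<in> K"
    proof -
      have "norm z = \<bar>Re z\<bar>" using that by (simp add: cmod_def)
      then show False using ab(3)[OF that(2)] n ab' by linarith
    qed
    then show "z \<in> \<Omega>" by (auto simp: \<Omega>_def)
  qed
  ultimately have "finite {z \<in> A. G z = 0}"
  \<comment> \<open>The finiteness theorem for zeros needs a nonconstant function. If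
    \<open>G\<close> is constant, it is 1 everywhere by its value at w.\<close>
  proof (cases "G constant_on \<Omega>")
    case True
    then have "G z = 1" if "z \<in> \<Omega>" for z using Gw w\<Omega> that unfolding constant_on_def by metis
    then have empty: "{z \<in> A. G z = 0} = {}" using \<open>A \<subseteq> \<Omega>\<close> by (auto dest!: subsetD)
    show ?thesis unfolding empty by simp
  next
    case False
    then show ?thesis
      using holomorphic_compact_finite_zeros[OF G_hol open_\<Omega> conn_\<Omega> \<open>compact A\<close> \<open>A \<subseteq> \<Omega>\<close>] by blast
  qed
  \<comment> \<open>Finitely many zeros spoil only finitely many radii.\<close>
  then have "finite (norm ` {z \<in> A. G z = 0})" by simp
  moreover have "infinite {a'<..<b'}" using ab' by simp
  ultimately obtain R where R: "R \<in> {a'<..<b'}" "R \<notin> norm ` {z \<in> A. G z = 0}"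
    by (meson finite_subset subsetI)
  have sph: "sphere 0 R \<subseteq> A" using R(1) by (auto simp: A_def)
  have R0: "R > 0" using R(1) ab' ab(1) by auto
  have "compact (sphere (0 :: complex) R)" by simp
  moreover have "sphere (0 :: complex) R \<noteq> {}" using R0 by (simp add: sphere_eq_empty)
  moreover have "continuous_on (sphere 0 R) (\<lambda>z. norm (G z))"
    using holomorphic_on_imp_continuous_on[OF G_hol] sph \<open>A \<subseteq> \<Omega>\<close>
    by (intro continuous_on_norm) (meson continuous_on_subset)
  ultimately obtain z0 where z0: "z0 \<in> sphere 0 R" "\<And>z. z \<in> sphere 0 R \<Longrightarrow> norm (G z0) \<le> norm (G z)"
    using continuous_attains_inf by metis
  have "G z0 \<noteq> 0" using z0(1) R(2) sph by (auto simp: image_iff)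
  define c where "c = norm (G z0)"
  have c: "c > 0" using \<open>G z0 \<noteq> 0\<close> by (simp add: c_def)
  \<comment> \<open>A lower bound for the distance of the circle of radius R from the support, which
    has no points with modulus strictly between a and b.\<close>
  define \<delta> where "\<delta> = min (R - a) (b - R)"
  have \<delta>: "\<delta> > 0" using R(1) ab' by (auto simp: \<delta>_def)
  define D where "D = (C + (R + norm w) * (2 * C / \<delta>)) / c"
  have on_sphere: "norm (cpoly p z) \<le> D * poly_norm p" if z: "z \<in> sphere 0 R" for p z
  proof -
    have AE: "AE x in M. norm (complex_of_real x - z) \<ge> \<delta>"
      using K(3)
    proof eventually_elim
      case (elim x)
      have "\<bar>\<bar>x\<bar> - R\<bar> \<le> norm (complex_of_real x - z)"
        using norm_triangle_ineq3[of "complex_of_real x" z] z by simp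
      moreover have "\<bar>\<bar>x\<bar> - R\<bar> \<ge> \<delta>" using ab(3)[OF elim] by (auto simp: \<delta>_def)
      ultimately show ?case by linarith
    qed
    have "norm (cpoly p z) * c \<le> norm (cpoly p z) * norm (G z)"
      unfolding c_def using z0(2)[OF z] by (intro mult_left_mono) auto
    also have "\<dots> \<le> (C + norm (z - w) * (2 * C / \<delta>)) * poly_norm p"
      using z sph \<open>A \<subseteq> \<Omega>\<close> by (intro bound[OF \<delta> AE]) auto
    also have "\<dots> \<le> (C + (R + norm w) * (2 * C / \<delta>)) * poly_norm p"
      using norm_triangle_ineq4[of z w] z C(1) \<delta> poly_norm_nonneg
      by (intro mult_right_mono add_left_mono) auto
    finally show ?thesis using c by (simp add: D_def field_simps)
  qed
  have "\<bar>poly p x\<bar> \<le> D * poly_norm p" if "\<bar>x\<bar> \<le> a" for p x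
  proof -
    have "norm (cpoly p (of_real x)) \<le> D * poly_norm p"
    proof (rule maximum_modulus_frontier[of "cpoly p" "cball 0 R"])
      show "cpoly p holomorphic_on interior (cball 0 R)" by (intro holomorphic_intros)
      show "continuous_on (closure (cball 0 R)) (cpoly p)" by (intro continuous_intros)
      show "norm (cpoly p z) \<le> D * poly_norm p" if "z \<in> frontier (cball 0 R)" for z
        using that by (intro on_sphere) simp
      show "complex_of_real x \<in> cball 0 R" using \<open>\<bar>x\<bar> \<le> a\<close> R(1) ab' by simp
    qed simp
    then show ?thesis by (simp add: cpoly_of_real)
  qed
  then show ?thesis by (rule that)
qed

end

subsection \<open>The measure on the powers of q\<close>

text \<open>Let a be the mass and choose p with squared distance below a/4 from the indicator. The
  contribution of \<open>x0\<close> alone forces |p(x0)| to be at least 1/2, while the squared norm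
  of p is at most 2(a/4) + 2a, hence at most 4a. So 1/4 is at most 4 a times the square of D, which
  gives the constant 16.\<close>

lemma (in orthonormal_measure) point_mass_eval_bound:
  assumes "poly_approximable (indicator {x0})" and pos: "measure M {x0} > 0"
    and D: "\<And>p. \<bar>poly p x0\<bar> \<le> D * poly_norm p"
  shows "1 \<le> 16 * D\<^sup>2 * measure M {x0}"
proof -
  define a where "a = measure M {x0}"
  have a: "a > 0" "a / 4 > 0" using pos by (auto simp: a_def)
  have ind: "integrable M (indicator {x0} :: real \<Rightarrow> real)"
    by (simp add: integrable_indicator_iff emeasure_eq_measure)
  have sq: "(indicator {x0} x :: real)\<^sup>2 = indicator {x0} x" for x :: real
    by (simp add: indicator_def)
  obtain p where p: "(\<integral>x. (indicator {x0} x - poly p x)\<^sup>2 \<partial>M) < a / 4"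
    using assms(1) a(2) unfolding poly_approximable_def by blast
  have i: "integrable M (\<lambda>x. (indicator {x0} x - poly p x)\<^sup>2)"
    using integrable_square_add[of "indicator {x0}" "poly (- p)"] ind by (simp add: sq)
  have "(1 - poly p x0)\<^sup>2 * a = (\<integral>x. (1 - poly p x0)\<^sup>2 * indicator {x0} x \<partial>M)"
    using ind by (simp add: a_def)
  also have "\<dots> \<le> (\<integral>x. (indicator {x0} x - poly p x)\<^sup>2 \<partial>M)"
  proof (rule integral_mono)
    show "integrable M (\<lambda>x. (1 - poly p x0)\<^sup>2 * indicator {x0} x)" using ind by simp
  qed (use i in \<open>auto simp: indicator_def\<close>)
  finally have "(1 - poly p x0)\<^sup>2 * a < (1 / 2)\<^sup>2 * a" using p by (simp add: power2_eq_square)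
  then have "(1 - poly p x0)\<^sup>2 < (1 / 2)\<^sup>2" using a(1) by (simp only: mult_less_cancel_right_pos)
  then have "\<bar>1 - poly p x0\<bar> < 1 / 2" by (rule power2_less_imp_less[of "\<bar>1 - poly p x0\<bar>" "1/2", simplified power2_abs]) simp
  then have "1 / 2 \<le> \<bar>poly p x0\<bar>" by linarith
  then have "1 / 2 \<le> D * poly_norm p" using D[of p] by linarith
  then have "(1 / 2)\<^sup>2 \<le> (D * poly_norm p)\<^sup>2" by (intro power_mono) auto
  moreover have "(poly_norm p)\<^sup>2 \<le> 4 * a"
  proof -
    have "(poly_norm p)\<^sup>2 = (\<integral>x. ((poly p x - indicator {x0} x) + indicator {x0} x)\<^sup>2 \<partial>M)"
      by (simp add: poly_norm_def)
    also have "\<dots> \<le> 2 * (\<integral>x. (poly p x - indicator {x0} x)\<^sup>2 \<partial>M) + 2 * (\<integral>x. (indicator {x0} x)\<^sup>2 \<partial>M)"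
      using i ind by (intro integral_square_add_le) (auto simp: sq power2_commute[of "poly p _"])
    also have "\<dots> \<le> 4 * a" using p a by (simp add: sq power2_commute[of "poly p _"] a_def)
    finally show ?thesis .
  qed
  ultimately have "(1 / 2)\<^sup>2 \<le> D\<^sup>2 * (4 * a)"
    unfolding power_mult_distrib by (meson mult_left_mono order_trans zero_le_power2)
  then show ?thesis by (simp add: a_def power2_eq_square)
qed

context
  fixes q v :: real and \<omega> :: "real \<Rightarrow> real"
  assumes q: "0 < q" "q < 1"
begin

lemma q_powi_inj: "q powi m = q powi n \<Longrightarrow> m = n"
proof (induction m n rule: linorder_wlog)
  case (le m n)
  show ?case
  proof (rule ccontr)
    assume "m \<noteq> n"
    then have "q powi n < q powi m" using le q by (intro power_int_strict_decreasing) auto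
    then show False using le by simp
  qed
qed (simp add: eq_commute)

lemma sets_q_measure: "sets (q_measure q v \<omega>) = sets borel"
  by (simp add: q_measure_def)

lemma AE_q_measure: "AE x in q_measure q v \<omega>. x \<in> range (\<lambda>n::int. q powi n)"
  unfolding q_measure_def
proof (subst AE_distr_iff)
  have "countable (range (\<lambda>n::int. q powi n))" by simp
  then show "{x \<in> space borel. x \<in> range (\<lambda>n::int. q powi n)} \<in> sets borel"
    by (auto intro: sets.countable)
qed auto

lemma q_measure_point_pos:
  assumes "finite_measure (q_measure q v \<omega>)" "\<omega> (q powi n) \<noteq> 0"
  shows "measure (q_measure q v \<omega>) {q powi n} > 0"
proof -
  interpret finite_measure "q_measure q v \<omega>" by fact
  define w where "w n = ennreal ((1 - q) * q powi n * (\<omega> (q powi n))\<^sup>2 * \<bar>q powi n\<bar> powr (2 * v + 1))" for n :: int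
  have qn: "q powi n > 0" using q by simp
  have "emeasure (q_measure q v \<omega>) {q powi n} = emeasure (density (count_space UNIV) w) {n}"
  proof -
    have "(\<lambda>n. q powi n) -` {q powi n} = {n}" using q_powi_inj by auto
    then show ?thesis unfolding q_measure_def w_def by (subst emeasure_distr) auto
  qed
  also have "\<dots> = w n" by (simp add: emeasure_density nn_integral_count_space_indicator[symmetric] nn_integral_indicator_singleton)
  finally have "emeasure (q_measure q v \<omega>) {q powi n} > 0"
    using q qn assms(2) by (simp add: w_def)
  then show ?thesis by (simp add: emeasure_eq_measure)
qed

end

text \<open>Near a point x outside the set only finitely many powers matter: large exponents give
  values below |x| / 2, and very negative ones give values above |x| + 1.\<close>

lemma closed_insert_zero_powi:
  assumes q: "0 < (q :: real)" "q < 1"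
  shows "closed (insert 0 (range (\<lambda>n::int. q powi n)))"
proof -
  have "open (- insert 0 (range (\<lambda>n::int. q powi n)))"
    unfolding open_dist
  proof
    fix x assume x: "x \<in> - insert 0 (range (\<lambda>n::int. q powi n))"
    obtain N where N: "q ^ N < \<bar>x\<bar> / 2" using real_arch_pow_inv[of "\<bar>x\<bar> / 2" q] x q by auto
    obtain N' where N': "(1 / q) ^ N' > \<bar>x\<bar> + 1" using real_arch_pow[of "1 / q" "\<bar>x\<bar> + 1"] q by auto
    define F where "F = (\<lambda>n::int. q powi n) ` {- int N'..int N}"
    have "finite F" by (simp add: F_def)
    moreover have "x \<notin> F" using x by (auto simp: F_def)
    ultimately obtain d where d: "d > 0" "\<And>y. y \<in> F \<Longrightarrow> d \<le> dist x y"
      using finite_set_avoid[of F x] by metis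
    define e where "e = min d (min 1 (\<bar>x\<bar> / 2))"
    have "e > 0" using d x by (auto simp: e_def)
    moreover have "y \<notin> insert 0 (range (\<lambda>n::int. q powi n))" if y: "dist y x < e" for y
    proof
      assume "y \<in> insert 0 (range (\<lambda>n::int. q powi n))"
      then consider "y = 0" | n :: int where "y = q powi n" by auto
      then show False
      proof cases
        case 1 then show False using y x by (auto simp: e_def dist_real_def)
      next
        case (2 n)
        consider "n > int N" | "n < - int N'" | "n \<in> {- int N'..int N}" by force
        then show False
        proof cases
          case 1
          then have "q powi n \<le> q powi int N" using q by (intro power_int_decreasing) auto
          then have "y < \<bar>x\<bar> / 2" "y > 0" using N 2 q by (auto simp: power_int_of_nat)
          moreover have "\<bar>y - x\<bar> < \<bar>x\<bar> / 2" using y by (simp add: e_def dist_real_def)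
          ultimately show False by arith
        next
          case 2
          then have "q powi (- int N') \<le> q powi n" using q by (intro power_int_decreasing) auto
          then have "y > \<bar>x\<bar> + 1" using N' \<open>y = q powi n\<close> by (simp add: power_int_minus power_one_over inverse_eq_divide)
          then show False using y by (auto simp: e_def dist_real_def)
        next
          case 3
          then have "d \<le> dist x y" using d(2) 2 by (auto simp: F_def)
          then show False using y by (auto simp: e_def dist_commute)
        qed
      qed
    qed
    ultimately show "\<exists>e>0. \<forall>y. dist y x < e \<longrightarrow> y \<in> - insert 0 (range (\<lambda>n::int. q powi n))" by blast
  qed
  then show ?thesis by (simp add: closed_def)
qed

theorem theorem1:
  fixes q v :: real and \<omega> :: "real \<Rightarrow> real" and P :: "nat \<Rightarrow> real poly"
  assumes "0 < q" and "q < 1" and "v > -1"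
    and "\<And>x. \<omega> (- x) = \<omega> x"
    and "\<And>n::int. \<omega> (q powi n) \<noteq> 0"
    and "has_all_moments (q_measure q v \<omega>)"
    and "orthonormal_polys (q_measure q v \<omega>) P"
  shows "orthonormal_basis_L2 (q_measure q v \<omega>) (\<lambda>n x. poly (P n) x)
           \<longleftrightarrow> determinate (q_measure q v \<omega>)"
proof -
  note q = \<open>0 < q\<close> \<open>q < 1\<close>
  define \<mu> where "\<mu> = q_measure q v \<omega>"
  define X where "X = range (\<lambda>n::int. q powi n)"
  have AE: "AE x in \<mu>. x \<in> X" unfolding \<mu>_def X_def by (rule AE_q_measure[OF q])
  have X: "countable X" by (simp add: X_def)
  interpret orthonormal_measure \<mu> P
    using assms(6,7) sets_q_measure[OF q] by unfold_locales (simp_all add: \<mu>_def)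
  have "determinate \<mu>" if dense: "\<forall>f\<in>L2 \<mu>. poly_approximable f"
  proof (rule ccontr)
    assume "\<not> determinate \<mu>"
    then obtain N where N: "sets N = sets borel" "has_all_moments N"
      "\<And>k. (\<integral>x. x ^ k \<partial>N) = (\<integral>x. x ^ k \<partial>\<mu>)" "N \<noteq> \<mu>"
      unfolding determinate_def by blast
    interpret N: moment_measure N using N by unfold_locales
    have "measure N UNIV = measure \<mu> UNIV" using N(3)[of 0] by simp
    then obtain w where w: "Im w > 0"
      "(\<integral>x. 1 / (complex_of_real x - w) \<partial>\<mu>) \<noteq> (\<integral>x. 1 / (complex_of_real x - w) \<partial>N)"
      using stieltjes_transform_differs[OF finite_measure_axioms N.finite_measure_axioms sets_eq N(1) X AE _ N(4)]
      by blast
    obtain C where C: "C \<ge> 0" "\<And>p. norm (cpoly p w) \<le> C * poly_norm p"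
      using eval_bounded_if_stieltjes_differs[OF N.moment_measure_axioms N(3) w] by blast
    \<comment> \<open>The Cauchy transforms need a closed countable carrier, so the limit point 0 is
      added.\<close>
    define K where "K = insert 0 X"
    have K: "closed K" "countable K" "AE x in \<mu>. x \<in> K"
      using closed_insert_zero_powi[OF q] X AE by (auto simp: K_def X_def)
    \<comment> \<open>Consecutive powers q and 1 leave the gap for the circle; all atoms with
      positive exponent lie in the disc of radius q inside it.\<close>
    have gap: "\<bar>x\<bar> \<le> q \<or> \<bar>x\<bar> \<ge> 1" if "x \<in> K" for x
    proof -
      have "\<bar>q powi n\<bar> \<le> q \<or> \<bar>q powi n\<bar> \<ge> 1" for n :: int
      proof (cases "n \<ge> 1")
        case True
        then have "q powi n \<le> q powi 1" using q by (intro power_int_decreasing) auto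
        then show ?thesis using q by simp
      next
        case False
        then have "q powi 0 \<le> q powi n" using q by (intro power_int_decreasing) auto
        then show ?thesis using q by simp
      qed
      then show ?thesis
        using that q(1) unfolding K_def X_def by (elim insertE rangeE) (simp, blast)
    qed
    obtain D where D: "\<And>p x. \<bar>x\<bar> \<le> q \<Longrightarrow> \<bar>poly p x\<bar> \<le> D * poly_norm p"
      using eval_bounded_near_zero[OF _ C K _ q(2) gap] w(1) q(1) by (metis less_imp_le less_irrefl)
    \<comment> \<open>The exponent starts at 1 so that every atom considered lies in the disc where
      D is valid.\<close>
    have "1 \<le> 16 * D\<^sup>2 * measure \<mu> {q powi int (Suc n)}" for n
    proof (rule point_mass_eval_bound)
      show "poly_approximable (indicator {q powi int (Suc n)})"
      proof (rule bspec[OF dense])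
        have "(indicator {y} x :: real)\<^sup>2 = indicator {y} x" for x y :: real by (simp add: indicator_def)
        then show "indicator {q powi int (Suc n)} \<in> L2 \<mu>"
          by (simp add: L2_def integrable_indicator_iff emeasure_eq_measure)
      qed
      show "measure \<mu> {q powi int (Suc n)} > 0"
        unfolding \<mu>_def using assms(5) finite_measure_axioms
        by (intro q_measure_point_pos[OF q]) (auto simp: \<mu>_def)
      have "q powi int (Suc n) \<le> q powi 1" using q by (intro power_int_decreasing) auto
      then show "\<bar>poly p (q powi int (Suc n))\<bar> \<le> D * poly_norm p" for p
        using q by (intro D) simp
    qed
    \<comment> \<open>Distinct atoms of a finite measure have summable masses, so these masses tend
      to 0 although all of them are bounded below.\<close>
    moreover have "(\<lambda>n. 16 * D\<^sup>2 * measure \<mu> {q powi int (Suc n)}) \<longlonglongrightarrow> 16 * D\<^sup>2 * 0"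
    proof (intro tendsto_intros summable_LIMSEQ_zero)
      have "disjoint_family (\<lambda>n. {q powi int (Suc n)})"
        by (auto simp: disjoint_family_on_def dest!: q_powi_inj[OF q])
      then have "(\<lambda>n. measure \<mu> {q powi int (Suc n)}) sums measure \<mu> (\<Union>n. {q powi int (Suc n)})"
        by (intro finite_measure_UNION) auto
      then show "summable (\<lambda>n. measure \<mu> {q powi int (Suc n)})" by (rule sums_summable)
    qed
    ultimately have "1 \<le> 16 * D\<^sup>2 * (0 :: real)"
      by (intro LIMSEQ_le_const) auto
    then show False by simp
  qed
  moreover have "\<forall>f\<in>L2 \<mu>. poly_approximable f" if "determinate \<mu>"
    using poly_approximable_purely_atomic[OF X AE]
      determinate_imp_indicator_approximable[OF that integral_square_pos] by blast
  ultimately show ?thesis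
    unfolding \<mu>_def[symmetric] orthonormal_basis_iff by blast
qed

end
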